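(* Let $m,n$ be nonnegative integers, let $i<m$, and let $f:\subseteq\mathbf R^m\to\mathbf R^n$ be an analytic function with open domain. Write $e_i\in\mathbf N^m$ for the vector whose $i$-th component is $1$ and whose other components are $0$. For a nonzero "polynomial" $P=(P_0,\dots,P_{n-1})$ in $k$ arguments (see context), write the condition $$(\ast)_x:\quad P\bigl(f x,\ \mathrm D^{e_i}f x,\ \mathrm D^{2e_i}f x,\ \dots,\ \mathrm D^{(k-1)e_i} f x\bigr)=0 .$$ Consider the statements: (i) for every open connected set $J\subseteq\operatorname{dom} f$ there is a nonzero $\mathbf Z^n$-coefficient polynomial $P$ such that $(\ast)_x$ holds for all $x\in J$; (ii) for each $x_0\in\operatorname{dom} f$ there are a nonzero $\mathbf Z^n$-coefficient polynomial $P$ and an open set $J$ containing $x_0$ such that $(\ast)_x$ holds for all $x\in J$; (iii) for each $x_0\in\operatorname{dom} f$ there are a nonzero $\mathbf Z^n$-coefficient polynomial $P$ and an open interval $J\subseteq\mathbf R$ containing the $i$-th component of $x_0$ such that $(\ast)_x$ holds for all $x$ whose $i$-th component lies in $J$ and whose other components equal those of $x_0$; (iv) for each $x\in\operatorname{dom} f$ there is a nonzero $\mathbf Z^n$-coefficient polynomial $P$ such that $(\ast)_x$ holds; and let (i$_\mathbf R$), (ii$_\mathbf R$), (iii$_\mathbf R$) be the statements obtained from (i), (ii), (iii) by replacing "$\mathbf Z^n$-coefficient" with "$\mathbf R^n$-coefficient". Then (i), (ii), (iii), (iv), (i$_\mathbf R$), (ii$_\mathbf R$), (iii$_\mathbf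 R$) are all equivalent.
   Context: Functions may be partial: $f:\subseteq\mathbf R^m\to\mathbf R^n$ means $f$ is defined on a set $\operatorname{dom} f\subseteq\mathbf R^m$. A function with open domain is analytic if near every point of its domain it is given by a convergent multivariate power series. For analytic $f$ and $a=(a_0,\dots,a_{m-1})\in\mathbf N^m$, $\mathrm D^a f$ denotes the mixed partial derivative of order $a_j$ in the $j$-th variable. A nonzero $\mathbf Z^n$-coefficient (resp. $\mathbf R^n$-coefficient) polynomial $P$ in $k$ arguments means an $n$-tuple $P=(P_0,\dots,P_{n-1})$ of nonzero polynomials in $k$ real variables with integer (resp. real) coefficients; for $y_0,\dots,y_{k-1}\in\mathbf R^n$, $P(y_0,\dots,y_{k-1})$ is the vector in $\mathbf R^n$ whose $j$-th component is $P_j$ evaluated at the $j$-th components of $y_0,\dots,y_{k-1}$. (Here $\mathbf N=\{0,1,2,\dots\}$.) *)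

theory Defs
  imports "HOL-Analysis.Analysis"
begin

text \<open>Points of R^m are vectors of type real^'m (m = CARD('m) >= 1, automatic since i < m).
  A map f : R^m -> R^n is given by its n component functions F j, j < n.\<close>

definition real_analytic_on :: "(real^'m \<Rightarrow> real) \<Rightarrow> (real^'m) set \<Rightarrow> bool" where
  "real_analytic_on g U \<longleftrightarrow> open U \<and>
     (\<forall>x0\<in>U. \<exists>r>0. ball x0 r \<subseteq> U \<and> (\<exists>c :: ('m \<Rightarrow> nat) \<Rightarrow> real.
        \<forall>x\<in>ball x0 r. ((\<lambda>a. c a * (\<Prod>j\<in>UNIV. (x$j - x0$j) ^ a j)) has_sum g x) UNIV))"

definition partial :: "'m \<Rightarrow> (real^'m \<Rightarrow> real) \<Rightarrow> real^'m \<Rightarrow> real" where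
  "partial i g x = deriv (\<lambda>t. g (x + t *\<^sub>R axis i 1)) 0"

definition Dpow :: "'m \<Rightarrow> nat \<Rightarrow> (real^'m \<Rightarrow> real) \<Rightarrow> real^'m \<Rightarrow> real" where
  "Dpow i l g = (partial i ^^ l) g"

definition is_mpoly :: "real set \<Rightarrow> nat \<Rightarrow> ((nat \<Rightarrow> nat) \<Rightarrow> real) \<Rightarrow> bool" where
  "is_mpoly S k c \<longleftrightarrow> finite {a. c a \<noteq> 0} \<and> (\<forall>a. c a \<noteq> 0 \<longrightarrow> (\<forall>j\<ge>k. a j = 0))
     \<and> (\<forall>a. c a \<in> S)"

definition mpoly_eval :: "nat \<Rightarrow> ((nat \<Rightarrow> nat) \<Rightarrow> real) \<Rightarrow> (nat \<Rightarrow> real) \<Rightarrow> real" where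
  "mpoly_eval k c y = (\<Sum>a | c a \<noteq> 0. c a * (\<Prod>j<k. y j ^ a j))"

text \<open>A nonzero S^n-coefficient polynomial in k arguments: n nonzero polynomials.\<close>
definition nonzero_poly_tuple ::
    "real set \<Rightarrow> nat \<Rightarrow> nat \<Rightarrow> (nat \<Rightarrow> (nat \<Rightarrow> nat) \<Rightarrow> real) \<Rightarrow> bool" where
  "nonzero_poly_tuple S n k P \<longleftrightarrow> (\<forall>j<n. is_mpoly S k (P j) \<and> P j \<noteq> (\<lambda>_. 0))"

definition star_cond ::
    "(nat \<Rightarrow> real^'m \<Rightarrow> real) \<Rightarrow> 'm \<Rightarrow> nat \<Rightarrow> nat \<Rightarrow> (nat \<Rightarrow> (nat \<Rightarrow> nat) \<Rightarrow> real)
      \<Rightarrow> real^'m \<Rightarrow> bool" where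
  "star_cond F i n k P x \<longleftrightarrow> (\<forall>j<n. mpoly_eval k (P j) (\<lambda>l. Dpow i l (F j) x) = 0)"

definition alg_on ::
    "real set \<Rightarrow> (nat \<Rightarrow> real^'m \<Rightarrow> real) \<Rightarrow> 'm \<Rightarrow> nat \<Rightarrow> (real^'m) set \<Rightarrow> bool" where
  "alg_on S F i n A \<longleftrightarrow> (\<exists>k P. nonzero_poly_tuple S n k P \<and> (\<forall>x\<in>A. star_cond F i n k P x))"

definition line_pt :: "real^'m \<Rightarrow> 'm \<Rightarrow> real \<Rightarrow> real^'m" where
  "line_pt x0 i t = (\<chi> j. if j = i then t else x0 $ j)"

end

theory Submission
  imports Defs "HOL-Complex_Analysis.Cauchy_Integral_Formula" "Jordan_Normal_Form.Determinant"
begin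

text \<open>
  (iii) with real coefficients implies (iii) with integer coefficients by elimination: the monomials
  of \<open>P\<close> and all their derivatives along the line satisfy one fixed linear relation, so the Gram
  determinant of the matrix of these derivatives vanishes.  It is an integer polynomial in the
  derivatives of \<open>f\<close>, and it is not the zero polynomial because a suitable interpolation
  polynomial makes the monomials linearly independent.

  (iv) implies (i) by Baire's theorem: countably many closed zero sets cover \<open>J\<close>, so
  one of the integer polynomials vanishes on a ball, and by analyticity along lines it then vanishes
  on the connected set \<open>J\<close>.
\<close>

section \<open>Integer polynomials in the derivatives\<close>

text \<open>A syntactic representation gives countability and the formal derivation for free.\<close>

hide_const (open) Module.smult

text \<open>Elimination starts from (iii_R), the weakest of the real statements: differentiating a
  relation in direction \<open>i\<close> only needs it on an interval of that line. The eliminating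
  polynomial has integer coefficients, so it may depend on the exponents of \<open>P\<close> but not
  on its real coefficients; these are treated as an unknown kernel vector. Over the reals the Gram
  matrix \<open>A^T A\<close> is singular exactly when the columns of the rectangular matrix
  \<open>A\<close> are dependent, so there may be more derivatives (rows) than monomials (columns)
  and no minor has to be selected. The danger is that the determinant is the zero polynomial. One
  argument where it does not vanish settles this: at the derivatives of a polynomial
  \<open>h\<close> the monomials become polynomials in \<open>t\<close>, whose independence is
  visible in finitely many derivatives at 0. It is forced by prescribing \<open>h\<close> and its
  first derivatives at finitely many points that separate the monomials. In the step from (iv) to
  (i) the identity theorem needs power series along lines only, but Baire needs continuity, which
  has to come from the multivariate series itself.\<close>

datatype iexp = Con int | Var nat | Add iexp iexp | Mul iexp iexp

instance iexp :: countable
  by countable_datatype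

primrec ev :: "iexp \<Rightarrow> (nat \<Rightarrow> real) \<Rightarrow> real" where
  "ev (Con z) y = of_int z"
| "ev (Var l) y = y l"
| "ev (Add p q) y = ev p y + ev q y"
| "ev (Mul p q) y = ev p y * ev q y"

primrec dv :: "iexp \<Rightarrow> iexp" where
  "dv (Con z) = Con 0"
| "dv (Var l) = Var (Suc l)"
| "dv (Add p q) = Add (dv p) (dv q)"
| "dv (Mul p q) = Add (Mul (dv p) q) (Mul p (dv q))"

lemma ev_has_derivative:
  assumes "\<And>l. ((\<lambda>t. y t l) has_field_derivative y t (Suc l)) (at t)"
  shows "((\<lambda>t. ev e (y t)) has_field_derivative ev (dv e) (y t)) (at t)"
proof (induction e)
  case (Mul p q)
  show ?case
    using DERIV_mult[OF Mul] by (simp add: add.commute mult.commute)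
qed (auto intro!: derivative_eq_intros assms)

definition intpoly :: "((nat \<Rightarrow> real) \<Rightarrow> real) \<Rightarrow> bool" where
  "intpoly f \<longleftrightarrow> (\<exists>e. \<forall>y. f y = ev e y)"

lemma intpoly_const: "z \<in> \<int> \<Longrightarrow> intpoly (\<lambda>y. z)"
  unfolding intpoly_def by (metis Ints_cases ev.simps(1))

lemma intpoly_ev: "intpoly (ev e)"
  unfolding intpoly_def by blast

lemma intpoly_var: "intpoly (\<lambda>y. y l)"
  unfolding intpoly_def by (metis ev.simps(2))

lemma intpoly_add: "intpoly f \<Longrightarrow> intpoly g \<Longrightarrow> intpoly (\<lambda>y. f y + g y)"
  unfolding intpoly_def by (metis ev.simps(3))

lemma intpoly_mult: "intpoly f \<Longrightarrow> intpoly g \<Longrightarrow> intpoly (\<lambda>y. f y * g y)"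
  unfolding intpoly_def by (metis ev.simps(4))

lemma intpoly_sum: "(\<And>s. s \<in> A \<Longrightarrow> intpoly (f s)) \<Longrightarrow> intpoly (\<lambda>y. \<Sum>s\<in>A. f s y)"
  by (induction A rule: infinite_finite_induct) (auto intro: intpoly_add intpoly_const)

lemma intpoly_prod: "(\<And>s. s \<in> A \<Longrightarrow> intpoly (f s)) \<Longrightarrow> intpoly (\<lambda>y. \<Prod>s\<in>A. f s y)"
  by (induction A rule: infinite_finite_induct) (auto intro: intpoly_mult intpoly_const)

lemma intpoly_power: "intpoly f \<Longrightarrow> intpoly (\<lambda>y. f y ^ k)"
  using intpoly_prod[of "{..<k}" "\<lambda>_. f"] by simp

lemma intpoly_monomial: "intpoly (\<lambda>y. \<Prod>j<k. y j ^ a j)"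
  by (intro intpoly_prod intpoly_power intpoly_var)

lemma mpoly_eval_superset:
  assumes "finite A" "{a. c a \<noteq> 0} \<subseteq> A"
  shows "mpoly_eval k c y = (\<Sum>a\<in>A. c a * (\<Prod>j<k. y j ^ a j))"
  unfolding mpoly_eval_def using assms by (intro sum.mono_neutral_left) auto

lemma intpoly_mpoly_eval: "is_mpoly \<int> k c \<Longrightarrow> intpoly (mpoly_eval k c)"
  unfolding is_mpoly_def mpoly_eval_def
  by (intro intpoly_sum intpoly_mult intpoly_const intpoly_monomial) auto

lemma is_mpoly_mono:
  assumes "is_mpoly S k c" "k \<le> k'"
  shows "is_mpoly S k' c" "mpoly_eval k' c = mpoly_eval k c"
proof -
  show "is_mpoly S k' c"
    using assms unfolding is_mpoly_def by auto
  have "(\<Prod>j<k'. y j ^ a j) = (\<Prod>j<k. y j ^ a j)" if "c a \<noteq> 0" for y :: "nat \<Rightarrow> real" and a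
    using assms that unfolding is_mpoly_def by (intro prod.mono_neutral_right) auto
  then show "mpoly_eval k' c = mpoly_eval k c"
    unfolding mpoly_eval_def by (intro ext sum.cong) auto
qed

text \<open>Different indices may carry the same exponent vector, as happens when a product is
  multiplied out, so coefficients are collected over the fibres of \<open>\<alpha>\<close>.
  Cancellation is harmless, because the support only has to be contained in the image of
  \<open>\<alpha>\<close>.\<close>

lemma mpoly_of_monomial_sum:
  assumes "finite I" "\<And>p. p \<in> I \<Longrightarrow> z p \<in> \<int>" "\<And>p j. p \<in> I \<Longrightarrow> j \<ge> k \<Longrightarrow> \<alpha> p j = 0"
  shows "\<exists>c. is_mpoly \<int> k c \<and> mpoly_eval k c = (\<lambda>y. \<Sum>p\<in>I. z p * (\<Prod>j<k. y j ^ \<alpha> p j))"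
proof -
  define c where "c a = (\<Sum>p\<in>{p \<in> I. \<alpha> p = a}. z p)" for a
  have c0: "c a = 0" if "a \<notin> \<alpha> ` I" for a
  proof -
    have "{p \<in> I. \<alpha> p = a} = {}" using that by auto
    then show ?thesis unfolding c_def by (simp only: sum.empty)
  qed
  then have sub: "{a. c a \<noteq> 0} \<subseteq> \<alpha> ` I" by blast
  have "is_mpoly \<int> k c"
    unfolding is_mpoly_def
  proof (intro conjI allI impI)
    show "finite {a. c a \<noteq> 0}" using sub assms(1) finite_surj by blast
    show "a j = 0" if "c a \<noteq> 0" "k \<le> j" for a j
    proof -
      have "a \<in> \<alpha> ` I" using c0 that(1) by blast
      then obtain p where "p \<in> I" "\<alpha> p = a" by blast
      then show ?thesis using assms(3)[of p j] that(2) by simp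
    qed
    show "c a \<in> \<int>" for a unfolding c_def using assms(2) by (intro Ints_sum) auto
  qed
  moreover have "mpoly_eval k c y = (\<Sum>p\<in>I. z p * (\<Prod>j<k. y j ^ \<alpha> p j))" for y
  proof -
    have "mpoly_eval k c y = (\<Sum>a\<in>\<alpha> ` I. c a * (\<Prod>j<k. y j ^ a j))"
      using assms(1) sub by (intro mpoly_eval_superset) auto
    also have "\<dots> = (\<Sum>a\<in>\<alpha> ` I. \<Sum>p\<in>{p \<in> I. \<alpha> p = a}. z p * (\<Prod>j<k. y j ^ \<alpha> p j))"
      unfolding c_def by (intro sum.cong) (auto simp: sum_distrib_right)
    also have "\<dots> = (\<Sum>p\<in>I. z p * (\<Prod>j<k. y j ^ \<alpha> p j))"
      using assms(1) by (rule sum.image_gen[symmetric])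
    finally show ?thesis .
  qed
  ultimately show ?thesis by blast
qed

text \<open>The way back from syntax to coefficient functions; with
  \<open>intpoly_mpoly_eval\<close> it makes the two descriptions of integer polynomial functions
  interchangeable.\<close>

lemma ev_eq_mpoly_eval:
  "\<exists>k c. is_mpoly \<int> k c \<and> mpoly_eval k c = ev e"
proof (induction e)
  case (Con z)
  show ?case
    using mpoly_of_monomial_sum[of "{()}" "\<lambda>_. of_int z" 0 "\<lambda>_ _. 0"]
    by (auto simp: fun_eq_iff intro!: exI[of _ 0])
next
  case (Var l)
  have "(\<Prod>j<Suc l. y j ^ (if j = l then 1 else 0)) = y l" for y :: "nat \<Rightarrow> real"
    by simp
  then show ?case
    using mpoly_of_monomial_sum[of "{()}" "\<lambda>_. 1" "Suc l" "\<lambda>_ j. if j = l then 1 else 0"]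
    by (auto simp: fun_eq_iff intro!: exI[of _ "Suc l"])
next
  case (Add p q)
  then obtain k c k' c' where *: "is_mpoly \<int> k c" "mpoly_eval k c = ev p"
    "is_mpoly \<int> k' c'" "mpoly_eval k' c' = ev q" by blast
  define K where "K = max k k'"
  have c: "is_mpoly \<int> K c" "mpoly_eval K c = ev p" "is_mpoly \<int> K c'" "mpoly_eval K c' = ev q"
    using * is_mpoly_mono[of \<int> k c K] is_mpoly_mono[of \<int> k' c' K] by (auto simp: K_def)
  define A where "A = {a. c a \<noteq> 0} \<union> {a. c' a \<noteq> 0}"
  have A: "finite A" "\<And>a j. a \<in> A \<Longrightarrow> j \<ge> K \<Longrightarrow> a j = 0" "\<And>a. c a + c' a \<in> \<int>"
    using c unfolding A_def is_mpoly_def by auto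
  have "ev (Add p q) = (\<lambda>y. \<Sum>a\<in>A. (c a + c' a) * (\<Prod>j<K. y j ^ a j))"
    using mpoly_eval_superset[OF A(1), of c K] mpoly_eval_superset[OF A(1), of c' K] c
    by (auto simp: fun_eq_iff A_def algebra_simps sum.distrib)
  then show ?case
    using mpoly_of_monomial_sum[of A "\<lambda>a. c a + c' a" K "\<lambda>a. a"] A by metis
next
  case (Mul p q)
  then obtain k c k' c' where *: "is_mpoly \<int> k c" "mpoly_eval k c = ev p"
    "is_mpoly \<int> k' c'" "mpoly_eval k' c' = ev q" by blast
  define K where "K = max k k'"
  have c: "is_mpoly \<int> K c" "mpoly_eval K c = ev p" "is_mpoly \<int> K c'" "mpoly_eval K c' = ev q"
    using * is_mpoly_mono[of \<int> k c K] is_mpoly_mono[of \<int> k' c' K] by (auto simp: K_def)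
  define A where "A = {a. c a \<noteq> 0} \<times> {a. c' a \<noteq> 0}"
  have A: "finite A" "\<And>ab j. ab \<in> A \<Longrightarrow> j \<ge> K \<Longrightarrow> fst ab j + snd ab j = 0"
      "\<And>a b. c a * c' b \<in> \<int>"
    using c unfolding A_def is_mpoly_def by auto
  have "ev (Mul p q) y = (\<Sum>ab\<in>A. (c (fst ab) * c' (snd ab)) * (\<Prod>j<K. y j ^ (fst ab j + snd ab j)))" for y
  proof -
    have "ev (Mul p q) y = mpoly_eval K c y * mpoly_eval K c' y"
      using c by simp
    also have "\<dots> = (\<Sum>a | c a \<noteq> 0. \<Sum>b | c' b \<noteq> 0.
        (c a * (\<Prod>j<K. y j ^ a j)) * (c' b * (\<Prod>j<K. y j ^ b j)))"
      unfolding mpoly_eval_def by (rule sum_product)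
    also have "\<dots> = (\<Sum>ab\<in>A. (c (fst ab) * c' (snd ab)) * (\<Prod>j<K. y j ^ (fst ab j + snd ab j)))"
      unfolding A_def sum.cartesian_product
      by (intro sum.cong) (auto simp: power_add prod.distrib)
    finally show ?thesis .
  qed
  then show ?case
    using mpoly_of_monomial_sum[of A "\<lambda>ab. c (fst ab) * c' (snd ab)" K "\<lambda>ab j. fst ab j + snd ab j"] A
    by (metis ext)
qed

section \<open>Gram determinants as integer polynomials\<close>

no_notation vec_nth (infixl \<open>$\<close> 90)

text \<open>With \<open>A\<close> the matrix of the \<open>a r s\<close>, the determinant is that of
  \<open>A^T A\<close>. If this matrix kills \<open>v\<close>, then \<open>v^T A^T A v\<close>, the
  squared length of \<open>A v\<close>, is 0, which over the reals forces
  \<open>A v = 0\<close>.\<close>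

lemma gram_det_eq_0_iff:
  fixes a :: "nat \<Rightarrow> nat \<Rightarrow> real"
  shows "Determinant.det (mat N N (\<lambda>(s, s'). \<Sum>r<R. a r s * a r s')) = 0 \<longleftrightarrow>
    (\<exists>c. (\<exists>s<N. c s \<noteq> 0) \<and> (\<forall>r<R. (\<Sum>s<N. a r s * c s) = 0))"
    (is "Determinant.det ?G = 0 \<longleftrightarrow> ?rhs")
proof -
  have G: "?G \<in> carrier_mat N N" by simp
  have entry: "(?G *\<^sub>v v) $ s = (\<Sum>r<R. a r s * (\<Sum>s'<N. a r s' * v $ s'))"
    if "v \<in> carrier_vec N" "s < N" for v s
  proof -
    have "(?G *\<^sub>v v) $ s = (\<Sum>s'<N. (\<Sum>r<R. a r s * a r s') * v $ s')"
      using that by (simp add: scalar_prod_def lessThan_atLeast0)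
    also have "\<dots> = (\<Sum>s'<N. \<Sum>r<R. a r s * (a r s' * v $ s'))"
      by (simp add: sum_distrib_right mult.assoc)
    also have "\<dots> = (\<Sum>r<R. a r s * (\<Sum>s'<N. a r s' * v $ s'))"
      by (subst sum.swap) (simp add: sum_distrib_left)
    finally show ?thesis .
  qed
  show ?thesis
  proof
    assume "Determinant.det ?G = 0"
    then obtain v where v: "v \<in> carrier_vec N" "v \<noteq> 0\<^sub>v N" "?G *\<^sub>v v = 0\<^sub>v N"
      using det_0_iff_vec_prod_zero_field[OF G] by blast
    define u where "u r = (\<Sum>s<N. a r s * v $ s)" for r
    have *: "(\<Sum>r<R. a r s * u r) = 0" if "s < N" for s
      using entry[OF v(1) that] v(3) that by (simp add: u_def)
    have "(\<Sum>r<R. (u r)\<^sup>2) = (\<Sum>r<R. \<Sum>s<N. v $ s * (a r s * u r))"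
      by (intro sum.cong) (auto simp: u_def power2_eq_square sum_distrib_left sum_distrib_right algebra_simps)
    also have "\<dots> = (\<Sum>s<N. v $ s * (\<Sum>r<R. a r s * u r))"
      by (subst sum.swap) (simp add: sum_distrib_left)
    also have "\<dots> = 0" using * by simp
    finally have "\<forall>r<R. u r = 0"
      by (simp add: sum_nonneg_eq_0_iff)
    moreover have "\<exists>s<N. v $ s \<noteq> 0"
      using v(1,2) by (metis carrier_vecD eq_vecI index_zero_vec)
    ultimately show ?rhs
      by (intro exI[of _ "\<lambda>s. v $ s"]) (simp add: u_def)
  next
    assume ?rhs
    then obtain c where c: "\<exists>s<N. c s \<noteq> 0" "\<forall>r<R. (\<Sum>s<N. a r s * c s) = 0" by blast
    define v where "v = vec N c"
    have v: "v \<in> carrier_vec N" by (simp add: v_def)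
    have "v \<noteq> 0\<^sub>v N"
      using c(1) by (metis index_vec index_zero_vec(1) v_def)
    moreover have "?G *\<^sub>v v = 0\<^sub>v N"
    proof (rule eq_vecI)
      show "(?G *\<^sub>v v) $ s = 0\<^sub>v N $ s" if "s < dim_vec (0\<^sub>v N)" for s
        using that c(2) unfolding entry[OF v, of s, unfolded index_zero_vec, OF that[unfolded index_zero_vec]]
        by (auto simp: v_def intro!: sum.neutral)
    qed simp
    ultimately show "Determinant.det ?G = 0"
      using det_0_iff_vec_prod_zero_field[OF G] v by blast
  qed
qed

notation vec_nth (infixl \<open>$\<close> 90)
no_notation vec_index (infixl \<open>$\<close> 100)

text \<open>The Leibniz formula has only signs as coefficients.\<close>

lemma intpoly_det:
  assumes "\<And>s s'. s < N \<Longrightarrow> s' < N \<Longrightarrow> intpoly (f s s')"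
  shows "intpoly (\<lambda>y. Determinant.det (mat N N (\<lambda>(s, s'). f s s' y)))"
proof -
  have "intpoly (\<lambda>y. \<Sum>p\<in>{p. p permutes {0..<N}}. signof p * (\<Prod>i = 0..<N. f i (p i) y))"
  proof (intro intpoly_sum intpoly_mult intpoly_prod intpoly_const)
    show "signof p \<in> (\<int> :: real set)" for p :: "nat \<Rightarrow> nat"
      by (simp add: sign_def)
    show "intpoly (f i (p i))" if "p \<in> {p. p permutes {0..<N}}" "i \<in> {0..<N}" for p i
      using that assms by (metis atLeastLessThan_iff mem_Collect_eq permutes_in_image)
  qed
  moreover have "Determinant.det (mat N N (\<lambda>(s, s'). f s s' y)) =
      (\<Sum>p\<in>{p. p permutes {0..<N}}. signof p * (\<Prod>i = 0..<N. f i (p i) y))" for y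
    unfolding det_def by (auto intro!: sum.cong prod.cong simp: permutes_in_image)
  ultimately show ?thesis by simp
qed

section \<open>Elimination of real coefficients\<close>

text \<open>Each derivative removes one unit of multiplicity. That the derivatives stay nonzero is
  carried through the induction: a vanishing derivative would come from a nonzero constant, which
  has no root.\<close>

lemma order_higher_pderiv:
  fixes p :: "real poly"
  assumes "p \<noteq> 0" "l \<le> Polynomial.order x p"
  shows "(pderiv ^^ l) p \<noteq> 0 \<and> Polynomial.order x ((pderiv ^^ l) p) = Polynomial.order x p - l"
  using assms(2)
proof (induction l)
  case (Suc l)
  let ?q = "(pderiv ^^ l) p"
  have q: "?q \<noteq> 0" "Polynomial.order x ?q = Polynomial.order x p - l" using Suc by auto
  then have root: "poly ?q x = 0" using Suc.prems by (auto simp: order_root)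
  have "Polynomial.order x ?q = Suc (Polynomial.order x (pderiv ?q))"
    using order_pderiv[OF q(1) root] .
  moreover have "pderiv ?q \<noteq> 0"
  proof
    assume "pderiv ?q = 0"
    then obtain a where "?q = [:a:]" using pderiv_iszero by blast
    then show False using q(1) root by simp
  qed
  ultimately show ?case using q(2) by simp
qed (use assms in simp)

lemma poly_higher_pderiv_eq_0:
  fixes p :: "real poly"
  assumes "p \<noteq> 0" "l < Polynomial.order x p"
  shows "poly ((pderiv ^^ l) p) x = 0"
proof -
  have "Polynomial.order x ((pderiv ^^ l) p) \<noteq> 0"
    using order_higher_pderiv[of p l x] assms by simp
  then show ?thesis by (meson order_root)
qed

lemma poly_higher_pderiv_order_neq_0:
  fixes p :: "real poly"
  assumes "p \<noteq> 0"
  shows "poly ((pderiv ^^ Polynomial.order x p) p) x \<noteq> 0"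
  using order_higher_pderiv[of p "Polynomial.order x p" x] assms by (simp add: order_root)

text \<open>Points are added one at a time, and at the new point the derivative conditions one at a
  time. The correction is a multiple of \<open>w\<close>, which vanishes to order at least
  \<open>k\<close> at the old points and to order exactly \<open>n\<close> at \<open>x\<close>, so
  it disturbs nothing already achieved.\<close>

lemma hermite_interpolation:
  fixes v :: "real \<Rightarrow> nat \<Rightarrow> real"
  assumes "finite T"
  shows "\<exists>h :: real poly. \<forall>x\<in>T. \<forall>l<k. poly ((pderiv ^^ l) h) x = v x l"
  using assms
proof (induction T)
  case (insert x T)
  have "\<exists>h. (\<forall>z\<in>T. \<forall>l<k. poly ((pderiv ^^ l) h) z = v z l) \<and>
      (\<forall>l<n. poly ((pderiv ^^ l) h) x = v x l)" for n
  proof (induction n)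
    case 0
    then show ?case using insert.IH by simp
  next
    case (Suc n)
    then obtain h where h: "\<forall>z\<in>T. \<forall>l<k. poly ((pderiv ^^ l) h) z = v z l"
      "\<forall>l<n. poly ((pderiv ^^ l) h) x = v x l" by blast
    define u where "u = (\<Prod>z\<in>T. [:-z, 1:] ^ k)"
    define w where "w = u * [:-x, 1:] ^ n"
    have ux: "poly u x \<noteq> 0"
      using insert.hyps unfolding u_def by (auto simp: poly_prod)
    then have w0: "w \<noteq> 0" by (auto simp: w_def)
    have "Polynomial.order x w = Polynomial.order x u + Polynomial.order x ([:-x, 1:] ^ n)"
      unfolding w_def by (rule order_mult) (use w0 w_def in simp)
    then have ow: "Polynomial.order x w = n"
      using order_0I[OF ux] order_power_n_n[of x n] by simp
    have oz: "k \<le> Polynomial.order z w" if "z \<in> T" for z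
    proof -
      have "[:-z, 1:] ^ k dvd u"
        unfolding u_def using insert.hyps(1) that by (rule dvd_prodI)
      then have "[:-z, 1:] ^ k dvd w" unfolding w_def by (rule dvd_mult2)
      then show ?thesis using w0 by (simp add: order_divides)
    qed
    \<comment> \<open>The divisor is nonzero because \<open>x\<close> is a root of \<open>w\<close>
      of multiplicity exactly \<open>n\<close>.\<close>
    define \<beta> where "\<beta> = (v x n - poly ((pderiv ^^ n) h) x) / poly ((pderiv ^^ n) w) x"
    have d: "(pderiv ^^ l) (h + smult \<beta> w) = (pderiv ^^ l) h + smult \<beta> ((pderiv ^^ l) w)" for l
      by (simp add: higher_pderiv_add higher_pderiv_smult)
    show ?case
    proof (intro exI[of _ "h + smult \<beta> w"] conjI ballI allI impI)
      show "poly ((pderiv ^^ l) (h + smult \<beta> w)) z = v z l" if "z \<in> T" "l < k" for z l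
        using h(1) that oz[OF that(1)] poly_higher_pderiv_eq_0[OF w0, of l z] by (simp add: d)
      show "poly ((pderiv ^^ l) (h + smult \<beta> w)) x = v x l" if "l < Suc n" for l
      proof (cases "l = n")
        case True
        have "poly ((pderiv ^^ n) w) x \<noteq> 0"
          using poly_higher_pderiv_order_neq_0[OF w0, of x] ow by simp
        then show ?thesis unfolding d True by (simp add: \<beta>_def)
      next
        case False
        then show ?thesis using that h(2) poly_higher_pderiv_eq_0[OF w0, of l x] ow by (simp add: d)
      qed
    qed
  qed
  from this[of k] show ?case by auto
qed simp

text \<open>Reduction modulo \<open>B\<close> recovers the lowest digit; the remaining digits
  satisfy the same equation.\<close>

lemma digit_sum_inj:
  fixes a b :: "nat \<Rightarrow> nat"
  assumes "\<forall>j<k. a j < B \<and> b j < B" "(\<Sum>j<k. a j * B ^ j) = (\<Sum>j<k. b j * B ^ j)"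
  shows "\<forall>j<k. a j = b j"
  using assms
proof (induction k arbitrary: a b)
  case (Suc k)
  have shift: "(\<Sum>j<Suc k. f j * B ^ j) = f 0 + B * (\<Sum>j<k. f (Suc j) * B ^ j)" for f :: "nat \<Rightarrow> nat"
    by (simp add: sum.lessThan_Suc_shift sum_distrib_left mult.left_commute del: sum.lessThan_Suc)
  have eq: "a 0 + B * (\<Sum>j<k. a (Suc j) * B ^ j) = b 0 + B * (\<Sum>j<k. b (Suc j) * B ^ j)"
    using Suc.prems(2) shift[of a] shift[of b] by simp
  have lt: "a 0 < B" "b 0 < B" using Suc.prems(1) by auto
  have 0: "a 0 = b 0"
    using arg_cong[OF eq, of "\<lambda>n. n mod B"] lt by simp
  moreover have "\<forall>j<k. a (Suc j) = b (Suc j)"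
  proof (rule Suc.IH)
    show "(\<Sum>j<k. a (Suc j) * B ^ j) = (\<Sum>j<k. b (Suc j) * B ^ j)"
      using eq 0 lt by simp
  qed (use Suc.prems in auto)
  ultimately show ?case by (metis less_Suc_eq_0_disj)
qed simp

text \<open>Kronecker substitution: along the curve \<open>y j = x ^ (B ^ j)\<close> distinct monomials become
  distinct powers of \<open>x\<close>.\<close>

lemma kronecker_points:
  fixes \<alpha> :: "nat \<Rightarrow> nat \<Rightarrow> nat"
  assumes inj: "inj_on \<alpha> {..<N}" and \<alpha>: "\<And>s j. s < N \<Longrightarrow> j \<ge> k \<Longrightarrow> \<alpha> s j = 0"
  shows "\<exists>(T :: real set) Y. finite T \<and>
    (\<forall>c. (\<forall>x\<in>T. (\<Sum>s<N. c s * (\<Prod>j<k. Y x j ^ \<alpha> s j)) = (0::real)) \<longrightarrow> (\<forall>s<N. c s = 0))"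
proof -
  \<comment> \<open>\<open>B\<close> exceeds all exponents, so they are digits to base
    \<open>B\<close>; the inserted 0 gives \<open>Max\<close> a value when \<open>N\<close> or
    \<open>k\<close> is 0.\<close>
  define B where "B = Suc (Max (insert 0 ((\<lambda>(s, j). \<alpha> s j) ` ({..<N} \<times> {..<k}))))"
  have B: "\<alpha> s j < B" if "s < N" "j < k" for s j
    unfolding B_def less_Suc_eq_le using that by (intro Max_ge) force+
  define d where "d s = (\<Sum>j<k. \<alpha> s j * B ^ j)" for s
  have dinj: "inj_on d {..<N}"
  proof (rule inj_onI)
    fix s s' assume s: "s \<in> {..<N}" "s' \<in> {..<N}" "d s = d s'"
    then have "\<forall>j<k. \<alpha> s j = \<alpha> s' j"
      using B unfolding d_def by (intro digit_sum_inj[of _ _ B]) auto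
    moreover have "\<alpha> s j = \<alpha> s' j" if "j \<ge> k" for j using \<alpha> s that by simp
    ultimately have "\<alpha> s = \<alpha> s'" by (metis ext leI)
    then show "s = s'" using inj s by (simp add: inj_on_def)
  qed
  define L where "L = Max (insert 0 (d ` {..<N}))"
  have L: "d s \<le> L" if "s < N" for s unfolding L_def using that by (intro Max_ge) auto
  \<comment> \<open>One point more than the degree bound \<open>L\<close>, so only the zero
    polynomial of degree at most \<open>L\<close> vanishes on \<open>T\<close>.\<close>
  define T where "T = real ` {..L}"
  have cardT: "card T = Suc L" unfolding T_def by (simp add: card_image)
  show ?thesis
  proof (intro exI[of _ T] exI[of _ "\<lambda>x j. x ^ (B ^ j)"] conjI allI[of "\<lambda>c :: nat \<Rightarrow> real. _ c \<longrightarrow> _ c"] impI)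
    show "finite T" by (simp add: T_def)
    fix c :: "nat \<Rightarrow> real"
    assume c: "\<forall>x\<in>T. (\<Sum>s<N. c s * (\<Prod>j<k. (x ^ (B ^ j)) ^ \<alpha> s j)) = 0"
    define Q where "Q = (\<Sum>s<N. monom (c s) (d s))"
    have "poly Q x = (\<Sum>s<N. c s * (\<Prod>j<k. (x ^ (B ^ j)) ^ \<alpha> s j))" for x
      unfolding Q_def poly_sum poly_monom d_def
      by (simp add: power_sum power_mult[symmetric] mult.commute)
    then have "T \<subseteq> {x. poly Q x = 0}" using c by auto
    moreover have "degree Q \<le> L"
      unfolding Q_def using L by (intro degree_sum_le) (auto intro: order_trans[OF degree_monom_le])
    ultimately have "Q = 0"
      using card_poly_roots_bound[of Q] card_mono[of "{x. poly Q x = 0}" T] poly_roots_finite[of Q] cardT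
      by fastforce
    show "\<forall>s<N. c s = 0"
    proof (intro allI impI)
      fix s assume s: "s < N"
      have "coeff Q (d s) = (\<Sum>s'<N. if s' = s then c s' else 0)"
        unfolding Q_def coeff_sum coeff_monom using dinj s
        by (intro sum.cong) (auto simp: inj_on_def)
      also have "\<dots> = c s" using s by simp
      finally show "c s = 0" using \<open>Q = 0\<close> by simp
    qed
  qed
qed

text \<open>Plays the role of \<open>y t\<close> when the analytic function is the polynomial
  \<open>h\<close>; jets are the test arguments at which the eliminating polynomial is shown to be
  nonzero.\<close>

definition jet :: "real poly \<Rightarrow> real \<Rightarrow> nat \<Rightarrow> real" where
  "jet h t l = poly ((pderiv ^^ l) h) t"

lemma ev_jet_poly: "\<exists>Q. \<forall>t. ev e (jet h t) = poly Q t"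
proof (induction e)
  case (Con z)
  show ?case by (intro exI[of _ "[:of_int z:]"]) simp
next
  case (Add p q)
  then show ?case by (metis ev.simps(3) poly_add)
next
  case (Mul p q)
  then show ?case by (metis ev.simps(4) poly_mult)
qed (auto simp: jet_def)

lemma ev_jet_has_derivative:
  "((\<lambda>t. ev e (jet h t)) has_field_derivative ev (dv e) (jet h t)) (at t)"
proof (rule ev_has_derivative)
  show "((\<lambda>t. jet h t l) has_field_derivative jet h t (Suc l)) (at t)" for l
    unfolding jet_def using poly_DERIV[of "(pderiv ^^ l) h" t] by simp
qed

text \<open>Along a jet the formal derivation \<open>dv\<close> is differentiation in
  \<open>t\<close>, and derivatives are unique.\<close>

lemma ev_higher_dv_jet:
  assumes "\<forall>t. ev e (jet h t) = poly Q t"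
  shows "ev ((dv ^^ r) e) (jet h t) = poly ((pderiv ^^ r) Q) t"
proof (induction r arbitrary: t)
  case (Suc r)
  then have "(\<lambda>t. ev ((dv ^^ r) e) (jet h t)) = poly ((pderiv ^^ r) Q)" by blast
  then have "(poly ((pderiv ^^ r) Q) has_field_derivative ev (dv ((dv ^^ r) e)) (jet h t)) (at t)"
    using ev_jet_has_derivative[of "(dv ^^ r) e" h t] by simp
  from DERIV_unique[OF this poly_DERIV] show ?case by simp
qed (use assms in simp)

text \<open>As many derivatives as the degree leave a constant: a factorial times the leading
  coefficient.\<close>

lemma poly_eq_0_if_higher_pderiv_0:
  fixes p :: "real poly"
  assumes "\<And>r. r \<le> degree p \<Longrightarrow> poly ((pderiv ^^ r) p) 0 = 0"
  shows "p = 0"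
proof (rule ccontr)
  assume "p \<noteq> 0"
  have "poly ((pderiv ^^ degree p) p) 0 = pochhammer 1 (degree p) * lead_coeff p"
    by (simp add: poly_0_coeff_0 coeff_higher_pderiv)
  moreover have "pochhammer (1::real) (degree p) \<noteq> 0"
    by (simp add: pochhammer_fact[symmetric])
  ultimately show False using assms[of "degree p"] \<open>p \<noteq> 0\<close> by simp
qed

text \<open>The coefficients of \<open>c\<close> form a kernel vector of the matrix of derivatives
  of the monomials at every \<open>t\<close>, so its Gram determinant vanishes there.
  \<open>e\<close> is chosen before \<open>T\<close> and \<open>y\<close>; the argument
  \<open>y0\<close> certifies that it is not the zero polynomial.\<close>

lemma eliminate_real_coefficients:
  assumes c: "is_mpoly UNIV k c" "c \<noteq> (\<lambda>_. 0)"
  obtains e y0 where "ev e y0 \<noteq> 0"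
    "\<And>T y t. open T \<Longrightarrow> (\<And>t l. t \<in> T \<Longrightarrow> ((\<lambda>t. y t l) has_field_derivative y t (Suc l)) (at t)) \<Longrightarrow>
      (\<And>t. t \<in> T \<Longrightarrow> mpoly_eval k c (y t) = 0) \<Longrightarrow> t \<in> T \<Longrightarrow> ev e (y t) = 0"
proof -
  have fin: "finite {a. c a \<noteq> 0}" using c(1) by (simp add: is_mpoly_def)
  then obtain \<alpha> N where \<alpha>: "{a. c a \<noteq> 0} = \<alpha> ` {i::nat. i < N}" "inj_on \<alpha> {i. i < N}"
    using finite_imp_nat_seg_image_inj_on by blast
  have Seg: "{i. i < N} = {..<N}" by auto
  note \<alpha> = \<alpha>[unfolded Seg]
  have c\<alpha>: "c (\<alpha> s) \<noteq> 0" if "s < N" for s using \<alpha>(1) that by blast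
  then have \<alpha>0: "\<alpha> s j = 0" if "s < N" "j \<ge> k" for s j
    using c(1) that unfolding is_mpoly_def by blast
  \<comment> \<open>The kernel vector must have a nonzero entry; the determinant of size 0 would be
    1.\<close>
  have N: "0 < N"
  proof (rule ccontr)
    assume "\<not> 0 < N"
    then have "{a. c a \<noteq> 0} = {}" using \<alpha>(1) by simp
    then show False using c(2) by auto
  qed
  have eval: "mpoly_eval k c y = (\<Sum>s<N. c (\<alpha> s) * (\<Prod>j<k. y j ^ \<alpha> s j))" for y
    unfolding mpoly_eval_def \<alpha>(1) by (subst sum.reindex[OF \<alpha>(2)]) simp
  have "\<forall>s. \<exists>e. \<forall>y. (\<Prod>j<k. y j ^ \<alpha> s j) = ev e y"
    using intpoly_monomial[of _ k] unfolding intpoly_def by blast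
  then obtain M where M: "\<And>s y. ev (M s) y = (\<Prod>j<k. y j ^ \<alpha> s j)" by metis
  obtain P :: "real set" and Y :: "real \<Rightarrow> nat \<Rightarrow> real" where P: "finite P"
    "\<forall>c. (\<forall>x\<in>P. (\<Sum>s<N. c s * (\<Prod>j<k. Y x j ^ \<alpha> s j)) = 0) \<longrightarrow> (\<forall>s<N. c s = 0)"
    using kronecker_points[OF \<alpha>(2), of k] \<alpha>0 by blast
  obtain h where h: "\<forall>x\<in>P. \<forall>l<k. poly ((pderiv ^^ l) h) x = Y x l"
    using hermite_interpolation[OF P(1)] by blast
  have "\<forall>s. \<exists>Q. \<forall>t. ev (M s) (jet h t) = poly Q t" using ev_jet_poly by blast
  then obtain Q where Q: "\<And>s. \<forall>t. ev (M s) (jet h t) = poly (Q s) t" by metis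
  \<comment> \<open>With \<open>R\<close> above all degrees, the first \<open>R\<close> derivatives
    at 0 determine every linear combination of the \<open>Q s\<close>.\<close>
  define R where "R = Suc (Max ((\<lambda>s. degree (Q s)) ` {..<N}))"
  have R: "degree (Q s) < R" if "s < N" for s
    unfolding R_def less_Suc_eq_le using that by (intro Max_ge) auto
  define A where "A r s = ev ((dv ^^ r) (M s))" for r s
  have "intpoly (\<lambda>y. Determinant.det (mat N N (\<lambda>(s, s'). \<Sum>r<R. A r s y * A r s' y)))"
    unfolding A_def by (intro intpoly_det intpoly_sum intpoly_mult intpoly_ev)
  then obtain e where e: "\<And>y. ev e y = Determinant.det (mat N N (\<lambda>(s, s'). \<Sum>r<R. A r s y * A r s' y))"
    unfolding intpoly_def by metis
  have e0: "ev e y = 0 \<longleftrightarrow> (\<exists>c. (\<exists>s<N. c s \<noteq> 0) \<and> (\<forall>r<R. (\<Sum>s<N. A r s y * c s) = 0))" for y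
    unfolding e by (rule gram_det_eq_0_iff)
  show thesis
  proof (rule that[of e "jet h 0"])
    show "ev e (jet h 0) \<noteq> 0"
    proof
      assume "ev e (jet h 0) = 0"
      then obtain b where b: "\<exists>s<N. b s \<noteq> 0" "\<forall>r<R. (\<Sum>s<N. A r s (jet h 0) * b s) = 0"
        unfolding e0 by blast
      \<comment> \<open>A kernel vector \<open>b\<close> at \<open>jet h 0\<close> makes all
        derivatives of \<open>p\<close> up to its degree vanish at 0, hence \<open>p = 0\<close>;
        but the values of \<open>p\<close> on \<open>P\<close> are the combinations of monomials
        that \<open>P\<close> separates.\<close>
      define p where "p = (\<Sum>s<N. smult (b s) (Q s))"
      have deg: "degree p < R"
        unfolding p_def using R by (intro degree_sum_less) (auto simp: R_def intro: le_less_trans[OF degree_smult_le])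
      have hp: "(pderiv ^^ r) p = (\<Sum>s<N. smult (b s) ((pderiv ^^ r) (Q s)))" for r
        unfolding p_def by (simp add: higher_pderiv_sum higher_pderiv_smult)
      have "p = 0"
      proof (rule poly_eq_0_if_higher_pderiv_0)
        fix r assume "r \<le> degree p"
        then have "(\<Sum>s<N. A r s (jet h 0) * b s) = 0" using b(2) deg by simp
        then show "poly ((pderiv ^^ r) p) 0 = 0"
          unfolding hp A_def ev_higher_dv_jet[OF Q] by (simp add: poly_sum mult.commute)
      qed
      have "(\<Sum>s<N. b s * (\<Prod>j<k. Y x j ^ \<alpha> s j)) = 0" if "x \<in> P" for x
      proof -
        have "(\<Sum>s<N. b s * (\<Prod>j<k. Y x j ^ \<alpha> s j)) = (\<Sum>s<N. b s * ev (M s) (jet h x))"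
          using h that by (simp add: M jet_def)
        also have "\<dots> = poly p x" by (simp add: p_def poly_sum Q)
        finally show ?thesis using \<open>p = 0\<close> by simp
      qed
      then have "\<forall>s<N. b s = 0" using P(2) by blast
      then show False using b(1) by blast
    qed
  next
    fix T y t
    assume T: "open T" "t \<in> T"
      and y: "\<And>t l. t \<in> T \<Longrightarrow> ((\<lambda>t. y t l) has_field_derivative y t (Suc l)) (at t)"
      and z: "\<And>t. t \<in> T \<Longrightarrow> mpoly_eval k c (y t) = 0"
    \<comment> \<open>The coefficients are constants and the relation holds throughout the open set
      \<open>T\<close>, so it may be differentiated repeatedly with the same coefficients.\<close>
    have "(\<Sum>s<N. A r s (y t) * c (\<alpha> s)) = 0" if "t \<in> T" for r t
      using that
    proof (induction r arbitrary: t)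
      case 0
      then show ?case using z[of t] by (simp add: eval A_def M mult.commute)
    next
      case (Suc r)
      have "((\<lambda>t. \<Sum>s<N. A r s (y t) * c (\<alpha> s)) has_field_derivative
          (\<Sum>s<N. A (Suc r) s (y t) * c (\<alpha> s))) (at t)"
        unfolding A_def using Suc.prems y
        by (auto intro!: DERIV_sum DERIV_cmult_right ev_has_derivative)
      moreover have "((\<lambda>t. \<Sum>s<N. A r s (y t) * c (\<alpha> s)) has_field_derivative 0) (at t)"
        by (rule has_field_derivative_transform_within_open[of "\<lambda>_. 0" _ _ T])
          (use Suc T in auto)
      ultimately show ?case by (rule DERIV_unique)
    qed
    then show "ev e (y t) = 0"
      unfolding e0 using N c\<alpha> T(2) by (intro exI[of _ "\<lambda>s. c (\<alpha> s)"]) blast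
  qed
qed

section \<open>Real analytic functions of several variables\<close>

text \<open>Turns a series over multi-indices into a power series in one variable; \<open>p\<close>
  will be the total degree or the exponent of one variable.\<close>

lemma has_sum_group_nat:
  fixes f :: "'a \<Rightarrow> real" and p :: "'a \<Rightarrow> nat"
  assumes "(f has_sum S) UNIV"
  shows "(\<lambda>n. infsum f {a. p a = n}) sums S"
proof -
  have "((\<lambda>(n, a). f a) has_sum S) (Sigma UNIV (\<lambda>n. {a. p a = n})) \<longleftrightarrow> (f has_sum S) UNIV"
    by (rule has_sum_reindex_bij_witness[where i = "\<lambda>a. (p a, a)" and j = snd]) auto
  then have *: "((\<lambda>(n, a). f a) has_sum S) (Sigma UNIV (\<lambda>n. {a. p a = n}))"
    using assms by blast
  have "((\<lambda>n. infsum f {a. p a = n}) has_sum S) UNIV"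
  proof (rule has_sum_SigmaD[OF *])
    have "f summable_on {a. p a = n}" for n
      using assms has_sum_imp_summable summable_on_subset_banach by blast
    then show "((\<lambda>y. case (n, y) of (n, a) \<Rightarrow> f a) has_sum infsum f {a. p a = n}) {a. p a = n}" for n
      by (simp add: has_sum_infsum)
  qed
  then show ?thesis by (rule has_sum_imp_sums)
qed

lemma real_analytic_onE:
  assumes "real_analytic_on g U" "x0 \<in> U"
  obtains r c where "r > 0" "ball x0 r \<subseteq> U"
    "\<And>x. x \<in> ball x0 r \<Longrightarrow> ((\<lambda>a. c a * (\<Prod>j\<in>UNIV. (x$j - x0$j) ^ a j)) has_sum g x) UNIV"
  using assms unfolding real_analytic_on_def by blast

text \<open>Weaker than analyticity and not even implying continuity, but sufficient for the
  identity theorem, and closed under products by the Cauchy product of one-variable series.\<close>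

definition line_analytic :: "(real^'m \<Rightarrow> real) \<Rightarrow> (real^'m) set \<Rightarrow> bool" where
  "line_analytic q U \<longleftrightarrow> (\<forall>x\<in>U. \<forall>v. \<exists>\<epsilon>>0. \<exists>b. \<forall>t. \<bar>t\<bar> < \<epsilon> \<longrightarrow>
     (\<lambda>n. b n * t ^ n) sums q (x + t *\<^sub>R v))"

text \<open>At \<open>x + t v\<close> the monomial with multi-index \<open>a\<close> is a constant
  times \<open>t\<close> to the total degree of \<open>a\<close>, so the series is grouped by total
  degree.\<close>

lemma real_analytic_on_imp_line_analytic:
  fixes g :: "real^'m \<Rightarrow> real"
  assumes "real_analytic_on g U"
  shows "line_analytic g U"
  unfolding line_analytic_def
proof (intro ballI allI)
  fix x v :: "real^'m" assume x: "x \<in> U"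
  obtain r c where r: "r > 0"
    and c: "\<And>y. y \<in> ball x r \<Longrightarrow> ((\<lambda>a. c a * (\<Prod>j\<in>UNIV. (y$j - x$j) ^ a j)) has_sum g y) UNIV"
    by (rule real_analytic_onE[OF assms x]) blast
  \<comment> \<open>Adding 1 to the norm covers \<open>v = 0\<close>.\<close>
  define \<epsilon> where "\<epsilon> = r / (norm v + 1)"
  define f where "f a = c a * (\<Prod>j\<in>UNIV. (v$j) ^ a j)" for a
  define p :: "('m \<Rightarrow> nat) \<Rightarrow> nat" where "p a = (\<Sum>j\<in>UNIV. a j)" for a
  have "(\<lambda>n. infsum f {a. p a = n} * t ^ n) sums g (x + t *\<^sub>R v)" if "\<bar>t\<bar> < \<epsilon>" for t
  proof -
    have "\<bar>t\<bar> * norm v \<le> \<bar>t\<bar> * (norm v + 1)" by (intro mult_left_mono) auto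
    also have "\<dots> < r" using that unfolding \<epsilon>_def by (simp add: pos_less_divide_eq add_nonneg_pos)
    finally have "x + t *\<^sub>R v \<in> ball x r" by (simp add: dist_norm)
    from c[OF this] have "((\<lambda>a. c a * (\<Prod>j\<in>UNIV. (t * v$j) ^ a j)) has_sum g (x + t *\<^sub>R v)) UNIV"
      by simp
    also have "(\<lambda>a. c a * (\<Prod>j\<in>UNIV. (t * v$j) ^ a j)) = (\<lambda>a. f a * t ^ p a)"
      by (auto simp: f_def p_def power_mult_distrib prod.distrib power_sum)
    finally have "(\<lambda>n. infsum (\<lambda>a. f a * t ^ p a) {a. p a = n}) sums g (x + t *\<^sub>R v)"
      by (rule has_sum_group_nat)
    moreover have "infsum (\<lambda>a. f a * t ^ p a) {a. p a = n} = infsum f {a. p a = n} * t ^ n" for n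
      unfolding infsum_cmult_left'[symmetric] by (rule infsum_cong) simp
    ultimately show ?thesis by simp
  qed
  moreover have "\<epsilon> > 0" using r by (simp add: \<epsilon>_def add_nonneg_pos)
  ultimately show "\<exists>\<epsilon>>0. \<exists>b. \<forall>t. \<bar>t\<bar> < \<epsilon> \<longrightarrow> (\<lambda>n. b n * t ^ n) sums g (x + t *\<^sub>R v)"
    by (intro exI[of _ \<epsilon>] conjI exI[of _ "\<lambda>n. infsum f {a. p a = n}"]) auto
qed

text \<open>The series at the diagonal point \<open>x + \<rho> u\<close> is a majorant: in
  \<open>g y - g x\<close> the constant terms cancel, and any other term is at most
  \<open>norm (y - x) / \<rho>\<close> times its absolute value on the diagonal. The resulting
  Lipschitz estimate at \<open>x\<close> gives continuity.\<close>

lemma real_analytic_on_imp_isCont: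
  fixes g :: "real^'m \<Rightarrow> real"
  assumes "real_analytic_on g U" "x \<in> U"
  shows "isCont g x"
proof -
  obtain r c where r: "r > 0"
    and c: "\<And>y. y \<in> ball x r \<Longrightarrow> ((\<lambda>a. c a * (\<Prod>j\<in>UNIV. (y$j - x$j) ^ a j)) has_sum g y) UNIV"
    by (rule real_analytic_onE[OF assms]) blast
  define u :: "real^'m" where "u = (\<chi> j. 1)"
  define \<rho> where "\<rho> = r / (norm u + 1)"
  have \<rho>: "\<rho> > 0" using r by (simp add: \<rho>_def add_nonneg_pos)
  have "\<rho> * norm u < \<rho> * (norm u + 1)" using \<rho> by (intro mult_strict_left_mono) auto
  also have "\<dots> = r" unfolding \<rho>_def using norm_ge_zero[of u] by (simp add: add_nonneg_eq_0_iff)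
  finally have \<rho>u: "\<rho> * norm u < r" .
  define p :: "('m \<Rightarrow> nat) \<Rightarrow> nat" where "p a = (\<Sum>j\<in>UNIV. a j)" for a
  have "x + \<rho> *\<^sub>R u \<in> ball x r" using \<rho>u \<rho> by (simp add: dist_norm)
  from c[OF this] have "((\<lambda>a. c a * (\<Prod>j\<in>UNIV. \<rho> ^ a j)) has_sum g (x + \<rho> *\<^sub>R u)) UNIV"
    by (simp add: u_def)
  then have "(\<lambda>a. c a * \<rho> ^ p a) summable_on UNIV"
    by (simp add: p_def power_sum has_sum_imp_summable)
  then have sm: "(\<lambda>a. \<bar>c a\<bar> * \<rho> ^ p a) summable_on UNIV"
    using \<rho> summable_on_iff_abs_summable_on_real[of "\<lambda>a. c a * \<rho> ^ p a" UNIV] by (simp add: abs_mult)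
  define B where "B = infsum (\<lambda>a. \<bar>c a\<bar> * \<rho> ^ p a) UNIV"
  have bound: "\<bar>g y - g x\<bar> \<le> norm (y - x) / \<rho> * B" if y: "norm (y - x) < min r \<rho>" for y
  proof -
    define s where "s = norm (y - x) / \<rho>"
    have s: "0 \<le> s" "s \<le> 1" using y \<rho> by (auto simp: s_def)
    have "y \<in> ball x r" "x \<in> ball x r" using y r by (auto simp: dist_norm norm_minus_commute)
    then have hs: "((\<lambda>a. c a * (\<Prod>j\<in>UNIV. (y$j - x$j) ^ a j) - c a * (\<Prod>j\<in>UNIV. (x$j - x$j) ^ a j))
        has_sum (g y - g x)) UNIV"
      using has_sum_add[OF c has_sum_uminusI[OF c]] by (simp only: add_uminus_conv_diff)
    have hB: "((\<lambda>a. s * (\<bar>c a\<bar> * \<rho> ^ p a)) has_sum norm (y - x) / \<rho> * B) UNIV"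
      unfolding s_def[symmetric] B_def using sm by (intro has_sum_cmult_right has_sum_infsum)
    have le: "\<bar>c a * (\<Prod>j\<in>UNIV. (y$j - x$j) ^ a j) - c a * (\<Prod>j\<in>UNIV. (x$j - x$j) ^ a j)\<bar>
        \<le> s * (\<bar>c a\<bar> * \<rho> ^ p a)" for a
      proof (cases "\<forall>j. a j = 0")
        case True
        then show ?thesis using s \<rho> by simp
      next
        case False
        then obtain j0 where j0: "a j0 \<noteq> 0" by blast
        then have z: "(\<Prod>j\<in>UNIV. (x$j - x$j) ^ a j) = 0"
          by (intro prod_zero) (auto simp: power_0_left)
        have p: "p a \<noteq> 0" using j0 by (auto simp: p_def)
        have "\<bar>\<Prod>j\<in>UNIV. (y$j - x$j) ^ a j\<bar> = (\<Prod>j\<in>UNIV. \<bar>y$j - x$j\<bar> ^ a j)"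
          by (simp add: abs_prod power_abs)
        also have "\<dots> \<le> (\<Prod>j\<in>UNIV. (s * \<rho>) ^ a j)"
        proof (intro prod_mono conjI power_mono)
          show "\<bar>y$j - x$j\<bar> \<le> s * \<rho>" for j
            using component_le_norm_cart[of "y - x" j] \<rho> by (simp add: s_def)
        qed auto
        also have "\<dots> = s ^ p a * \<rho> ^ p a" by (simp add: p_def power_sum power_mult_distrib prod.distrib)
        \<comment> \<open>Since \<open>p a\<close> is at least 1 and \<open>s \<le> 1\<close>, one
          factor \<open>s\<close> can be kept.\<close>
        also have "\<dots> \<le> s * \<rho> ^ p a"
          using s \<rho> power_decreasing[of 1 "p a" s] p by (intro mult_right_mono) auto
        finally have "\<bar>c a\<bar> * \<bar>\<Prod>j\<in>UNIV. (y$j - x$j) ^ a j\<bar> \<le> \<bar>c a\<bar> * (s * \<rho> ^ p a)"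
          by (intro mult_left_mono) auto
        then show ?thesis unfolding z by (simp add: abs_mult mult.left_commute)
      qed
    show ?thesis
    proof (rule abs_leI)
      show "g y - g x \<le> norm (y - x) / \<rho> * B"
        by (rule has_sum_mono[OF hs hB]) (use le abs_le_D1 in blast)
      show "- (g y - g x) \<le> norm (y - x) / \<rho> * B"
        by (rule has_sum_mono[OF has_sum_uminusI[OF hs] hB]) (use le abs_le_D2 in blast)
    qed
  qed
  have "((\<lambda>y. g y - g x) \<longlongrightarrow> 0) (at x)"
  proof (rule Lim_null_comparison)
    show "\<forall>\<^sub>F y in at x. norm (g y - g x) \<le> norm (y - x) / \<rho> * B"
      unfolding eventually_at
      using bound r \<rho> by (intro exI[of _ "min r \<rho>"]) (auto simp: dist_norm)
    have "((\<lambda>y. norm (y - x) / \<rho> * B) \<longlongrightarrow> norm (x - x) / \<rho> * B) (at x)"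
      using \<rho> by (intro tendsto_intros) auto
    then show "((\<lambda>y. norm (y - x) / \<rho> * B) \<longlongrightarrow> 0) (at x)" by simp
  qed
  then show ?thesis
    unfolding isCont_def using LIM_zero_iff by blast
qed

text \<open>\<open>K ^ n - w ^ n\<close> is \<open>K - w\<close> times a sum of \<open>n\<close>
  products, each at least \<open>w ^ (n - 1)\<close>. This lets a series at \<open>K\<close>
  dominate the differentiated series at \<open>w\<close>.\<close>

lemma power_diff_lower_bound:
  fixes w K :: real
  assumes "0 \<le> w" "w \<le> K"
  shows "of_nat n * w ^ (n - 1) * (K - w) \<le> K ^ n"
proof (cases n)
  case (Suc m)
  have "of_nat n * w ^ m = (\<Sum>i<n. w ^ m)" by simp
  also have "\<dots> \<le> (\<Sum>i<n. K ^ i * w ^ (n - Suc i))"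
  proof (rule sum_mono)
    fix i assume "i \<in> {..<n}"
    then have "w ^ m = w ^ i * w ^ (n - Suc i)" using Suc by (simp add: power_add[symmetric])
    also have "\<dots> \<le> K ^ i * w ^ (n - Suc i)"
      using assms by (intro mult_right_mono power_mono) auto
    finally show "w ^ m \<le> K ^ i * w ^ (n - Suc i)" .
  qed
  finally have "of_nat n * w ^ m * (K - w) \<le> (\<Sum>i<n. K ^ i * w ^ (n - Suc i)) * (K - w)"
    using assms by (intro mult_right_mono) auto
  also have "\<dots> = K ^ n - w ^ n"
    using power_diff_sumr2[of K n w] by (simp add: mult.commute)
  also have "\<dots> \<le> K ^ n" using assms by simp
  finally show ?thesis using Suc by simp
qed simp

text \<open>Grouping by the exponent of variable \<open>i\<close> gives a one-variable power series
  with derivative \<open>D\<close>. The real work is the summability of the ungrouped differentiated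
  family: the original family at a point further out dominates it, and regrouping identifies its sum
  with \<open>D\<close>.\<close>

lemma multivariate_termdiff:
  fixes g :: "real^'m \<Rightarrow> real"
  assumes ser: "\<And>x. x \<in> ball x0 r \<Longrightarrow>
      ((\<lambda>a. c a * (\<Prod>j\<in>UNIV. (x$j - x0$j) ^ a j)) has_sum g x) UNIV"
    and x: "x \<in> ball x0 r"
  shows "\<exists>S. ((\<lambda>a. of_nat (Suc (a i)) * c (a(i := Suc (a i))) * (\<Prod>j\<in>UNIV. (x$j - x0$j) ^ a j)) has_sum S) UNIV
    \<and> ((\<lambda>t. g (x + t *\<^sub>R axis i 1)) has_field_derivative S) (at 0)"
proof -
  define w where "w = x$i - x0$i"
  define C where "C a = c a * (\<Prod>j\<in>UNIV - {i}. (x$j - x0$j) ^ a j)" for a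
  \<comment> \<open>\<open>s\<close> is the offset of the \<open>i\<close>-th coordinate from the
    centre \<open>x0\<close>, so \<open>x\<close> itself is \<open>X w\<close>.\<close>
  define X where "X s = x + (s - w) *\<^sub>R axis i 1" for s
  define \<delta> where "\<delta> = r - dist x0 x"
  have \<delta>: "\<delta> > 0" using x by (simp add: \<delta>_def)
  have hs: "((\<lambda>a. C a * s ^ a i) has_sum g (X s)) UNIV" if "\<bar>s - w\<bar> < \<delta>" for s
  proof -
    have "dist x (X s) = \<bar>s - w\<bar>" by (simp add: X_def dist_norm)
    then have "X s \<in> ball x0 r"
      using that dist_triangle[of x0 "X s" x] by (simp add: \<delta>_def)
    from ser[OF this] show ?thesis
    proof (rule has_sum_cong[THEN iffD1, rotated])
      fix a :: "'m \<Rightarrow> nat"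
      have "(\<Prod>j\<in>UNIV. (X s$j - x0$j) ^ a j)
        = (X s$i - x0$i) ^ a i * (\<Prod>j\<in>UNIV - {i}. (X s$j - x0$j) ^ a j)"
        by (rule prod.remove) auto
      also have "X s$i - x0$i = s" by (simp add: X_def w_def)
      also have "(\<Prod>j\<in>UNIV - {i}. (X s$j - x0$j) ^ a j) = (\<Prod>j\<in>UNIV - {i}. (x$j - x0$j) ^ a j)"
        by (rule prod.cong) (auto simp: X_def axis_def)
      finally show "c a * (\<Prod>j\<in>UNIV. (X s$j - x0$j) ^ a j) = C a * s ^ a i"
        by (simp add: C_def)
    qed
  qed
  define B where "B n = infsum C {a. a i = n}" for n
  have B: "(\<lambda>n. B n * s ^ n) sums g (X s)" if "\<bar>s - w\<bar> < \<delta>" for s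
  proof -
    have "(\<lambda>n. infsum (\<lambda>a. C a * s ^ a i) {a. a i = n}) sums g (X s)"
      by (rule has_sum_group_nat[OF hs[OF that]])
    moreover have "infsum (\<lambda>a. C a * s ^ a i) {a. a i = n} = B n * s ^ n" for n
      unfolding B_def infsum_cmult_left'[symmetric] by (rule infsum_cong) simp
    ultimately show ?thesis by simp
  qed
  \<comment> \<open>Farther from 0 than \<open>w\<close>, yet within \<open>\<delta>\<close> of
    \<open>w\<close>, so the series still converges at \<open>X s1\<close>.\<close>
  define s1 where "s1 = (if w \<ge> 0 then w + \<delta> / 2 else w - \<delta> / 2)"
  have s1: "\<bar>s1 - w\<bar> < \<delta>" "\<bar>s1\<bar> = \<bar>w\<bar> + \<delta> / 2" using \<delta> by (auto simp: s1_def)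
  have ws1: "norm w < norm s1" using s1 \<delta> by simp
  have smK: "summable (\<lambda>n. B n * s1 ^ n)" using B[OF s1(1)] sums_summable by blast
  define D where "D = (\<Sum>n. diffs B n * w ^ n)"
  have "((\<lambda>s. \<Sum>n. B n * s ^ n) has_field_derivative D) (at w)"
    unfolding D_def by (rule termdiffs_strong[OF smK ws1])
  then have "((\<lambda>s. g (X s)) has_field_derivative D) (at w)"
    by (rule has_field_derivative_transform_within_open[of _ _ _ "ball w \<delta>"])
      (use \<delta> B in \<open>auto simp: dist_real_def abs_minus_commute sums_iff\<close>)
  then have der: "((\<lambda>t. g (x + t *\<^sub>R axis i 1)) has_field_derivative D) (at 0)"
    using DERIV_shift[of "\<lambda>s. g (X s)" D 0 w] by (simp add: X_def)
  define f where "f a = of_nat (a i) * w ^ (a i - 1) * C a" for a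
  have "(\<lambda>a. norm (f a)) summable_on UNIV"
  proof (rule Infinite_Sum.abs_summable_on_comparison_test)
    show "(\<lambda>a. norm (2 / \<delta> * (C a * s1 ^ a i))) summable_on UNIV"
      using hs[OF s1(1)]
      by (intro summable_on_iff_abs_summable_on_real[THEN iffD1] summable_on_cmult_right)
        (rule has_sum_imp_summable)
    fix a
    have *: "of_nat (a i) * \<bar>w\<bar> ^ (a i - 1) * (\<bar>s1\<bar> - \<bar>w\<bar>) \<le> \<bar>s1\<bar> ^ a i"
      using s1(2) \<delta> by (intro power_diff_lower_bound) auto
    have "of_nat (a i) * \<bar>w\<bar> ^ (a i - 1) \<le> 2 / \<delta> * \<bar>s1\<bar> ^ a i"
    proof -
      have "\<bar>s1\<bar> - \<bar>w\<bar> = \<delta> / 2" using s1(2) by simp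
      from *[unfolded this] show ?thesis using \<delta> by (simp add: field_simps)
    qed
    then have "of_nat (a i) * \<bar>w\<bar> ^ (a i - 1) * \<bar>C a\<bar> \<le> 2 / \<delta> * \<bar>s1\<bar> ^ a i * \<bar>C a\<bar>"
      by (intro mult_right_mono) auto
    then show "norm (f a) \<le> norm (2 / \<delta> * (C a * s1 ^ a i))"
      using \<delta> by (simp add: f_def abs_mult power_abs mult_ac)
  qed
  then have "f summable_on UNIV" using summable_on_iff_abs_summable_on_real by blast
  then have fS: "(f has_sum infsum f UNIV) UNIV" by (rule has_sum_infsum)
  have "(\<lambda>n. infsum f {a. a i = n}) sums infsum f UNIV"
    by (rule has_sum_group_nat[OF fS])
  moreover have "infsum f {a. a i = n} = of_nat n * B n * w ^ (n - Suc 0)" for n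
  proof -
    have "infsum f {a. a i = n} = infsum (\<lambda>a. (of_nat n * w ^ (n - 1)) * C a) {a. a i = n}"
      by (rule infsum_cong) (simp add: f_def)
    then show ?thesis by (simp add: infsum_cmult_right' B_def)
  qed
  ultimately have "(\<lambda>n. of_nat n * B n * w ^ (n - Suc 0)) sums infsum f UNIV" by simp
  moreover have "(\<lambda>n. of_nat n * B n * w ^ (n - Suc 0)) sums D"
    unfolding D_def
  proof (rule diffs_equiv, rule termdiff_converges[OF ws1])
    show "summable (\<lambda>n. B n * z ^ n)" if "norm z < norm s1" for z
      using powser_inside[OF smK that] .
  qed
  ultimately have "infsum f UNIV = D" by (rule sums_unique2)
  with fS have "(f has_sum D) UNIV" by simp
  \<comment> \<open>Terms with \<open>a i = 0\<close> carry the factor 0; once they are dropped,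
    raising the \<open>i\<close>-th exponent is a bijection onto the index set.\<close>
  then have "(f has_sum D) {a. a i \<noteq> 0}"
    by (subst has_sum_cong_neutral[of UNIV]) (auto simp: f_def)
  moreover have "((\<lambda>a. of_nat (Suc (a i)) * c (a(i := Suc (a i))) * (\<Prod>j\<in>UNIV. (x$j - x0$j) ^ a j)) has_sum D) UNIV
     \<longleftrightarrow> (f has_sum D) {a. a i \<noteq> 0}"
  proof (rule has_sum_reindex_bij_witness[where i = "\<lambda>a. a(i := a i - 1)" and j = "\<lambda>a. a(i := Suc (a i))"])
    fix a :: "'m \<Rightarrow> nat"
    have "(\<Prod>j\<in>UNIV. (x$j - x0$j) ^ a j) = w ^ a i * (\<Prod>j\<in>UNIV - {i}. (x$j - x0$j) ^ a j)"
      unfolding w_def by (rule prod.remove) auto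
    then show "f (a(i := Suc (a i))) = of_nat (Suc (a i)) * c (a(i := Suc (a i))) * (\<Prod>j\<in>UNIV. (x$j - x0$j) ^ a j)"
      by (simp add: f_def C_def)
  qed auto
  ultimately show ?thesis using der by blast
qed

text \<open>The expansion of the derivative is valid on the same ball. The second claim says that
  \<open>deriv\<close> in \<open>partial\<close> is a genuine derivative on
  \<open>U\<close>.\<close>

lemma partial_real_analytic:
  assumes "real_analytic_on g U"
  shows "real_analytic_on (partial i g) U"
    and "x \<in> U \<Longrightarrow> ((\<lambda>t. g (x + t *\<^sub>R axis i 1)) has_field_derivative partial i g x) (at 0)"
proof -
  show "real_analytic_on (partial i g) U"
    unfolding real_analytic_on_def
  proof (intro conjI ballI)
    show "open U" using assms by (simp add: real_analytic_on_def)
    fix x0 assume x0: "x0 \<in> U"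
    obtain r c where r: "r > 0" "ball x0 r \<subseteq> U"
      and c: "\<And>x. x \<in> ball x0 r \<Longrightarrow> ((\<lambda>a. c a * (\<Prod>j\<in>UNIV. (x$j - x0$j) ^ a j)) has_sum g x) UNIV"
      by (rule real_analytic_onE[OF assms x0]) blast
    have "((\<lambda>a. of_nat (Suc (a i)) * c (a(i := Suc (a i))) * (\<Prod>j\<in>UNIV. (x$j - x0$j) ^ a j))
        has_sum partial i g x) UNIV" if "x \<in> ball x0 r" for x
      using multivariate_termdiff[of x0 r c g x i] c that unfolding partial_def
      by (metis (no_types, lifting) DERIV_imp_deriv)
    then show "\<exists>r>0. ball x0 r \<subseteq> U \<and> (\<exists>c. \<forall>x\<in>ball x0 r.
        ((\<lambda>a. c a * (\<Prod>j\<in>UNIV. (x$j - x0$j) ^ a j)) has_sum partial i g x) UNIV)"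
      using r by (intro exI[of _ r] conjI exI[of _ "\<lambda>a. of_nat (Suc (a i)) * c (a(i := Suc (a i)))"]) auto
  qed
  show "((\<lambda>t. g (x + t *\<^sub>R axis i 1)) has_field_derivative partial i g x) (at 0)" if x: "x \<in> U"
  proof -
    obtain r c where r: "r > 0" "ball x r \<subseteq> U"
      and c: "\<And>y. y \<in> ball x r \<Longrightarrow> ((\<lambda>a. c a * (\<Prod>j\<in>UNIV. (y$j - x$j) ^ a j)) has_sum g y) UNIV"
      by (rule real_analytic_onE[OF assms x]) blast
    obtain S where "((\<lambda>t. g (x + t *\<^sub>R axis i 1)) has_field_derivative S) (at 0)"
      using multivariate_termdiff[of x r c g x i] c r by auto
    then show ?thesis unfolding partial_def by (metis DERIV_imp_deriv)
  qed
qed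

lemma real_analytic_on_Dpow:
  assumes "real_analytic_on g U"
  shows "real_analytic_on (Dpow i l g) U"
  using assms unfolding Dpow_def by (induction l) (auto intro: partial_real_analytic)

lemma Dpow_line_has_derivative:
  assumes "real_analytic_on g U" "line_pt x0 i t \<in> U"
  shows "((\<lambda>t. Dpow i l g (line_pt x0 i t)) has_field_derivative Dpow i (Suc l) g (line_pt x0 i t)) (at t)"
proof -
  have shift: "line_pt x0 i t + s *\<^sub>R axis i 1 = line_pt x0 i (s + t)" for s
    by (auto simp: line_pt_def axis_def Finite_Cartesian_Product.vec_eq_iff)
  have "((\<lambda>s. Dpow i l g (line_pt x0 i (s + t))) has_field_derivative partial i (Dpow i l g) (line_pt x0 i t)) (at 0)"
    using partial_real_analytic(2)[OF real_analytic_on_Dpow[OF assms(1), of i l] assms(2), of i]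
    by (simp add: shift)
  then show ?thesis
    using DERIV_shift[of "\<lambda>t. Dpow i l g (line_pt x0 i t)" _ 0 t] by (simp add: Dpow_def)
qed

section \<open>Closure properties of line analyticity and the identity theorem\<close>

lemma line_analytic_const: "line_analytic (\<lambda>_. z) U"
  unfolding line_analytic_def
proof (intro ballI allI)
  have "(\<lambda>n. (if n = 0 then z else 0) * t ^ n) sums z" for t
    using sums_single[of 0 "\<lambda>_. z"] by (rule sums_cong[THEN iffD1, rotated]) auto
  then show "\<exists>\<epsilon>>0. \<exists>b. \<forall>t. \<bar>t\<bar> < \<epsilon> \<longrightarrow> (\<lambda>n. b n * t ^ n) sums z"
    by (intro exI[of _ 1] conjI exI[of _ "\<lambda>n. if n = 0 then z else 0"]) auto
qed

lemma line_analytic_add: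
  assumes "line_analytic p U" "line_analytic q U"
  shows "line_analytic (\<lambda>x. p x + q x) U"
  unfolding line_analytic_def
proof (intro ballI allI)
  fix x v assume "x \<in> U"
  then obtain \<epsilon> b \<epsilon>' b' where "\<epsilon> > 0" "\<epsilon>' > 0"
    "\<And>t. \<bar>t\<bar> < \<epsilon> \<Longrightarrow> (\<lambda>n. b n * t ^ n) sums p (x + t *\<^sub>R v)"
    "\<And>t. \<bar>t\<bar> < \<epsilon>' \<Longrightarrow> (\<lambda>n. b' n * t ^ n) sums q (x + t *\<^sub>R v)"
    using assms unfolding line_analytic_def by metis
  then show "\<exists>\<epsilon>>0. \<exists>b. \<forall>t. \<bar>t\<bar> < \<epsilon> \<longrightarrow> (\<lambda>n. b n * t ^ n) sums (p (x + t *\<^sub>R v) + q (x + t *\<^sub>R v))"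
    by (intro exI[of _ "min \<epsilon> \<epsilon>'"] conjI exI[of _ "\<lambda>n. b n + b' n"])
      (auto simp: distrib_right intro: sums_add)
qed

lemma line_analytic_mult:
  assumes "line_analytic p U" "line_analytic q U"
  shows "line_analytic (\<lambda>x. p x * q x) U"
  unfolding line_analytic_def
proof (intro ballI allI)
  fix x v assume "x \<in> U"
  then obtain \<epsilon> b \<epsilon>' b' where \<epsilon>: "\<epsilon> > 0" "\<epsilon>' > 0"
    and b: "\<And>t. \<bar>t\<bar> < \<epsilon> \<Longrightarrow> (\<lambda>n. b n * t ^ n) sums p (x + t *\<^sub>R v)"
    and b': "\<And>t. \<bar>t\<bar> < \<epsilon>' \<Longrightarrow> (\<lambda>n. b' n * t ^ n) sums q (x + t *\<^sub>R v)"
    using assms unfolding line_analytic_def by metis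
  have "(\<lambda>n. (\<Sum>i\<le>n. b i * b' (n - i)) * t ^ n) sums (p (x + t *\<^sub>R v) * q (x + t *\<^sub>R v))"
    if t: "\<bar>t\<bar> < min \<epsilon> \<epsilon>'" for t
  proof -
    \<comment> \<open>Convergence at \<open>K\<close> beyond the absolute value of \<open>t\<close>
      gives the absolute convergence at \<open>t\<close> that the Cauchy product requires.\<close>
    obtain K where K: "\<bar>t\<bar> < K" "K < min \<epsilon> \<epsilon>'" using t dense by blast
    have "summable (\<lambda>n. b n * K ^ n)" "summable (\<lambda>n. b' n * K ^ n)"
      using b[of K] b'[of K] K by (auto simp: sums_iff)
    then have "summable (\<lambda>n. norm (b n * t ^ n))" "summable (\<lambda>n. norm (b' n * t ^ n))"
      using K by (auto intro!: powser_insidea[where x = K] simp del: real_norm_def simp: real_norm_def[of t] real_norm_def[of K])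
    then have "(\<lambda>n. \<Sum>i\<le>n. (b i * t ^ i) * (b' (n - i) * t ^ (n - i))) sums
        ((\<Sum>n. b n * t ^ n) * (\<Sum>n. b' n * t ^ n))"
      by (rule Cauchy_product_sums)
    moreover have "(\<Sum>i\<le>n. (b i * t ^ i) * (b' (n - i) * t ^ (n - i))) = (\<Sum>i\<le>n. b i * b' (n - i)) * t ^ n" for n
      unfolding sum_distrib_right by (intro sum.cong) (auto simp: power_add[symmetric])
    moreover have "(\<Sum>n. b n * t ^ n) = p (x + t *\<^sub>R v)" "(\<Sum>n. b' n * t ^ n) = q (x + t *\<^sub>R v)"
      using b[of t] b'[of t] t by (auto simp: sums_iff)
    ultimately show ?thesis by simp
  qed
  then show "\<exists>\<epsilon>>0. \<exists>b. \<forall>t. \<bar>t\<bar> < \<epsilon> \<longrightarrow> (\<lambda>n. b n * t ^ n) sums (p (x + t *\<^sub>R v) * q (x + t *\<^sub>R v))"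
    using \<epsilon> by (intro exI[of _ "min \<epsilon> \<epsilon>'"] conjI exI[of _ "\<lambda>n. \<Sum>i\<le>n. b i * b' (n - i)"]) auto
qed

lemma powser_zero_if_zeros_accumulate:
  fixes b :: "nat \<Rightarrow> real"
  assumes r: "0 < r" and b: "\<And>t. \<bar>t\<bar> < r \<Longrightarrow> (\<lambda>n. b n * t ^ n) sums G t"
    and z: "\<And>\<epsilon>. \<epsilon> > 0 \<Longrightarrow> \<exists>t. 0 < \<bar>t\<bar> \<and> \<bar>t\<bar> < \<epsilon> \<and> G t = 0"
    and t: "\<bar>t\<bar> < r"
  shows "G t = 0"
proof -
  \<comment> \<open>\<open>powser_0_nonzero\<close> wants a series that vanishes at the centre, hence the extra factor \<open>t\<close>.\<close>
  define b' where "b' n = (case n of 0 \<Rightarrow> 0 | Suc k \<Rightarrow> b k)" for n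
  have sm: "(\<lambda>n. b' n * (t - 0) ^ n) sums (t * G t)" if "norm (t - 0) < r" for t
  proof -
    have "(\<lambda>n. t * (b n * t ^ n)) sums (t * G t)" using b[of t] that by (intro sums_mult) auto
    then have "(\<lambda>n. b' (Suc n) * (t - 0) ^ Suc n) sums (t * G t)"
      by (simp add: b'_def mult_ac)
    then show ?thesis
      by (rule sums_Suc_imp[rotated]) (simp add: b'_def)
  qed
  have "b m = 0" for m
  proof (rule ccontr)
    assume "b m \<noteq> 0"
    then have m: "b' (Suc m) \<noteq> 0" by (simp add: b'_def)
    obtain s where s: "0 < s" "\<And>t. t \<in> cball 0 s - {0} \<Longrightarrow> t * G t \<noteq> 0"
      by (rule powser_0_nonzero[OF r sm _ m]) auto
    from z[OF s(1)] s(2) show False by force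
  qed
  then have "(\<lambda>n. 0) sums G t" using b[OF t] by simp
  then show ?thesis by (simp add: sums_iff)
qed

text \<open>The points near which \<open>G\<close> vanishes form a clopen part of the interval: at a
  limit point of them zeros accumulate and annihilate the local series.\<close>

lemma identity_unit_interval:
  fixes G :: "real \<Rightarrow> real"
  assumes ser: "\<And>t. t \<in> {0..1} \<Longrightarrow> \<exists>r>0. \<exists>b. \<forall>s. \<bar>s\<bar> < r \<longrightarrow> (\<lambda>n. b n * s ^ n) sums G (t + s)"
    and \<delta>: "\<delta> > 0" "\<And>t. \<bar>t\<bar> < \<delta> \<Longrightarrow> G t = 0"
  shows "G 1 = 0"
proof -
  define Z where "Z = {t. \<exists>\<epsilon>>0. \<forall>s. \<bar>s - t\<bar> < \<epsilon> \<longrightarrow> G s = 0}"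
  have "open Z"
    unfolding open_dist
  proof
    fix t assume "t \<in> Z"
    then obtain \<epsilon> where \<epsilon>: "\<epsilon> > 0" "\<And>s. \<bar>s - t\<bar> < \<epsilon> \<Longrightarrow> G s = 0" unfolding Z_def by blast
    have "u \<in> Z" if "dist u t < \<epsilon> / 2" for u
    proof -
      have "G s = 0" if "\<bar>s - u\<bar> < \<epsilon> / 2" for s
        using \<open>dist u t < \<epsilon> / 2\<close> that abs_triangle_ineq[of "s - u" "u - t"]
        by (intro \<epsilon>(2)) (simp add: dist_real_def)
      then show ?thesis unfolding Z_def using \<epsilon>(1) half_gt_zero by blast
    qed
    then show "\<exists>e>0. \<forall>y. dist y t < e \<longrightarrow> y \<in> Z" using \<epsilon>(1) half_gt_zero by blast
  qed
  then have op: "openin (top_of_set {0..1}) ({0..1} \<inter> Z)" by (simp add: openin_open_Int)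
  moreover have "closedin (top_of_set {0..1}) ({0..1} \<inter> Z)"
    unfolding closedin_limpt
  proof (intro conjI allI impI)
    fix t assume t: "t islimpt {0..1} \<inter> Z \<and> t \<in> {0..1}"
    then obtain r b where r: "r > 0" and b: "\<And>s. \<bar>s\<bar> < r \<Longrightarrow> (\<lambda>n. b n * s ^ n) sums G (t + s)"
      using ser[of t] by blast
    have "G (t + s) = 0" if "\<bar>s\<bar> < r" for s
    proof (rule powser_zero_if_zeros_accumulate[OF r b _ that])
      fix \<epsilon> :: real assume "\<epsilon> > 0"
      then obtain u where u: "u \<in> {0..1} \<inter> Z" "u \<noteq> t" "dist u t < \<epsilon>"
        using t unfolding islimpt_approachable by blast
      then have "G u = 0" unfolding Z_def by force
      then show "\<exists>s. 0 < \<bar>s\<bar> \<and> \<bar>s\<bar> < \<epsilon> \<and> G (t + s) = 0"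
        using u by (intro exI[of _ "u - t"]) (auto simp: dist_real_def)
    qed
    then have "G s = 0" if "\<bar>s - t\<bar> < r" for s using that by (metis add.commute diff_add_cancel)
    then show "t \<in> {0..1} \<inter> Z" using r t unfolding Z_def by blast
  qed auto
  moreover have "0 \<in> {0..1} \<inter> Z" using \<delta> by (auto simp: Z_def)
  ultimately have eq: "{0..1} \<inter> Z = {0..1}"
    using connected_clopen[THEN iffD1, OF connected_Icc, rule_format, of 0 1 "{0..1} \<inter> Z"] by blast
  have "1 \<in> {0..1} \<inter> Z" unfolding eq by simp
  then obtain \<epsilon> where "\<epsilon> > 0" "\<forall>s. \<bar>s - 1\<bar> < \<epsilon> \<longrightarrow> G s = 0" unfolding Z_def by blast
  then show ?thesis by simp
qed

text \<open>Inside a ball contained in \<open>J\<close>, vanishing near one point spreads along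
  segments to the whole ball, by convexity; connectedness of \<open>J\<close> passes the local
  property \<open>P\<close> from ball to ball.\<close>

lemma line_analytic_identity:
  fixes q :: "real^'m \<Rightarrow> real"
  assumes J: "open J" "connected J" and q: "line_analytic q J"
    and z: "z \<in> J" "r > 0" "\<And>x. x \<in> ball z r \<Longrightarrow> q x = 0"
    and x: "x \<in> J"
  shows "q x = 0"
proof -
  define P where "P x \<longleftrightarrow> (\<exists>\<epsilon>>0. \<forall>y\<in>ball x \<epsilon>. q y = 0)" for x
  have "P x"
  proof (rule connected_induction_simple[OF J(2) z(1) x])
    show "P z" using z by (auto simp: P_def)
    fix a assume "a \<in> J"
    then obtain R where R: "R > 0" "ball a R \<subseteq> J" using J(1) open_contains_ball by blast
    have spread: "P w" if y: "y \<in> ball a R" "P y" and w: "w \<in> ball a R" for y w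
    proof -
      obtain \<epsilon> where \<epsilon>: "\<epsilon> > 0" "\<And>u. u \<in> ball y \<epsilon> \<Longrightarrow> q u = 0" using y(2) P_def by blast
      have zero: "q u = 0" if u: "u \<in> ball a R" for u
      proof -
        define G where "G t = q (y + t *\<^sub>R (u - y))" for t
        have "G 1 = 0"
        proof (rule identity_unit_interval)
          fix t :: real assume t: "t \<in> {0..1}"
          have "y + t *\<^sub>R (u - y) = (1 - t) *\<^sub>R y + t *\<^sub>R u" by (simp add: algebra_simps)
          also have "\<dots> \<in> ball a R"
            using y(1) u t by (intro convexD_alt[OF convex_ball]) auto
          finally have "y + t *\<^sub>R (u - y) \<in> J" using R by blast
          then obtain r b where r: "r > 0" "\<And>s. \<bar>s\<bar> < r \<Longrightarrow>
              (\<lambda>n. b n * s ^ n) sums q ((y + t *\<^sub>R (u - y)) + s *\<^sub>R (u - y))"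
            using q unfolding line_analytic_def by meson
          then show "\<exists>r>0. \<exists>b. \<forall>s. \<bar>s\<bar> < r \<longrightarrow> (\<lambda>n. b n * s ^ n) sums G (t + s)"
            unfolding G_def
            by (intro exI[of _ r] conjI exI[of _ b]) (simp_all add: add.assoc scaleR_left_distrib)
        next
          show "\<epsilon> / (norm (u - y) + 1) > 0" using \<epsilon> by (simp add: add_nonneg_pos)
          fix t assume t: "\<bar>t\<bar> < \<epsilon> / (norm (u - y) + 1)"
          have "\<bar>t\<bar> * norm (u - y) \<le> \<bar>t\<bar> * (norm (u - y) + 1)" by (intro mult_left_mono) auto
          also have "\<dots> < \<epsilon>" using t by (simp add: pos_less_divide_eq add_nonneg_pos)
          finally show "G t = 0" unfolding G_def by (intro \<epsilon>(2)) (simp add: dist_norm)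
        qed
        then show ?thesis by (simp add: G_def)
      qed
      obtain \<epsilon>' where "\<epsilon>' > 0" "ball w \<epsilon>' \<subseteq> ball a R"
        using w open_contains_ball[of "ball a R"] open_ball by blast
      then show ?thesis unfolding P_def using zero by blast
    qed
    have "openin (top_of_set J) (ball a R)" using R by (simp add: openin_open_eq J(1))
    moreover have "a \<in> ball a R" using R(1) by simp
    ultimately show "\<exists>T. openin (top_of_set J) T \<and> a \<in> T \<and> (\<forall>x\<in>T. \<forall>y\<in>T. P x \<longrightarrow> P y)"
      using spread by blast
  qed
  then obtain \<epsilon> where "\<epsilon> > 0" "\<forall>y\<in>ball x \<epsilon>. q y = 0" unfolding P_def by blast
  then show ?thesis by simp
qed

text \<open>Otherwise, within a closed ball in \<open>J\<close>, each set \<open>T e\<close> of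
  nonzeros is relatively open and dense. By Baire their intersection is dense in that ball, whereas
  \<open>cover\<close> makes it empty.\<close>

lemma baire_zero_ball:
  fixes f :: "'b \<Rightarrow> 'a::euclidean_space \<Rightarrow> real"
  assumes J: "open J" "J \<noteq> {}" and E: "countable E"
    and cont: "\<And>e. e \<in> E \<Longrightarrow> continuous_on J (f e)"
    and cover: "\<And>x. x \<in> J \<Longrightarrow> \<exists>e\<in>E. f e x = 0"
  shows "\<exists>e\<in>E. \<exists>z r. 0 < r \<and> ball z r \<subseteq> J \<and> (\<forall>x\<in>ball z r. f e x = 0)"
proof (rule ccontr)
  assume no: "\<not> ?thesis"
  obtain z0 R where R: "R > 0" "cball z0 R \<subseteq> J"
    using J open_contains_cball by blast
  define T where "T e = {x \<in> cball z0 R. f e x \<noteq> 0}" for e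
  have "cball z0 R \<subseteq> closure (\<Inter>(T ` E))"
  proof (rule Baire)
    show "countable (T ` E)" using E by simp
    fix V assume "V \<in> T ` E"
    then obtain e where e: "e \<in> E" "V = T e" by blast
    have cc: "continuous_on (cball z0 R) (f e)" using cont[OF e(1)] R continuous_on_subset by blast
    have "openin (top_of_set (cball z0 R)) (cball z0 R \<inter> f e -` (- {0}))"
      using continuous_openin_preimage_gen[OF cc, of "- {0}"] by auto
    moreover have "cball z0 R \<inter> f e -` (- {0}) = T e" by (auto simp: T_def)
    moreover have "x \<in> closure (T e)" if "x \<in> cball z0 R" for x
    proof (rule ccontr)
      assume nx: "x \<notin> closure (T e)"
      \<comment> \<open>\<open>x\<close> may lie on the boundary sphere, so the ball of zeros is
        sought around a nearby point \<open>u\<close> of the open ball.\<close>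
      define V where "V = (- closure (T e)) \<inter> ball z0 R"
      have "x \<in> closure (ball z0 R)" using that R by simp
      then have "(- closure (T e)) \<inter> ball z0 R \<noteq> {}"
        using nx open_Int_closure_eq_empty[of "- closure (T e)" "ball z0 R"] by auto
      then obtain u where "u \<in> V" unfolding V_def by blast
      moreover have "open V" by (auto simp: V_def)
      ultimately obtain s where s: "s > 0" "ball u s \<subseteq> V" using open_contains_ball by blast
      have "f e y = 0" if "y \<in> ball u s" for y
      proof -
        have "y \<in> V" using s that by blast
        then have "y \<notin> T e" "y \<in> cball z0 R" using closure_subset[of "T e"] by (auto simp: V_def)
        then show ?thesis by (simp add: T_def)
      qed
      moreover have "ball u s \<subseteq> J"
        using s(2) R(2) ball_subset_cball[of z0 R] unfolding V_def by blast
      ultimately show False using no e(1) s(1) by blast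
    qed
    ultimately show "openin (top_of_set (cball z0 R)) V \<and> cball z0 R \<subseteq> closure V"
      using e(2) by auto
  qed simp
  moreover have "\<Inter>(T ` E) = {}"
  proof -
    have "x \<notin> \<Inter>(T ` E)" for x
    proof
      assume x: "x \<in> \<Inter>(T ` E)"
      have "z0 \<in> J" using R by auto
      \<comment> \<open>An empty \<open>E\<close> would make the intersection the whole space; a
        member of \<open>E\<close> places \<open>x\<close> in the closed ball, where
        \<open>cover\<close> applies.\<close>
      then obtain e0 where "e0 \<in> E" using cover by blast
      then have "x \<in> J" using x R by (auto simp: T_def)
      then obtain e where "e \<in> E" "f e x = 0" using cover by blast
      then show False using x by (auto simp: T_def)
    qed
    then show ?thesis by blast
  qed
  ultimately show False using R(1) by auto
qed

section \<open>The equivalences\<close>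

lemma line_analytic_ev:
  assumes "\<And>l. line_analytic (\<lambda>x. y x l) U"
  shows "line_analytic (\<lambda>x. ev e (y x)) U"
  by (induction e) (auto intro: line_analytic_const line_analytic_add line_analytic_mult assms)

lemma continuous_on_ev:
  assumes "\<And>l. continuous_on U (\<lambda>x. y x l)"
  shows "continuous_on U (\<lambda>x. ev e (y x))"
  by (induction e) (auto intro: continuous_intros assms)

text \<open>The arities of the components are raised to a common one.\<close>

lemma alg_onI:
  assumes "\<And>j. j < n \<Longrightarrow> \<exists>k c. is_mpoly S k c \<and> c \<noteq> (\<lambda>_. 0) \<and>
    (\<forall>x\<in>A. mpoly_eval k c (\<lambda>l. Dpow i l (F j) x) = 0)"
  shows "alg_on S F i n A"
proof -
  from assms obtain k P where P: "\<And>j. j < n \<Longrightarrow> is_mpoly S (k j) (P j) \<and> P j \<noteq> (\<lambda>_. 0) \<and>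
    (\<forall>x\<in>A. mpoly_eval (k j) (P j) (\<lambda>l. Dpow i l (F j) x) = 0)" by metis
  define K where "K = Max (insert 0 (k ` {..<n}))"
  have K: "k j \<le> K" if "j < n" for j unfolding K_def using that by (intro Max_ge) auto
  show ?thesis
    unfolding alg_on_def nonzero_poly_tuple_def star_cond_def
  proof (intro exI[of _ K] exI[of _ P] conjI allI impI ballI)
    fix j assume j: "j < n"
    show "is_mpoly S K (P j)" "P j \<noteq> (\<lambda>_. 0)"
      using P[OF j] is_mpoly_mono(1)[OF _ K[OF j]] by auto
    show "mpoly_eval K (P j) (\<lambda>l. Dpow i l (F j) x) = 0" if "x \<in> A" for x
      using P[OF j] that is_mpoly_mono(2)[OF _ K[OF j], of S "P j"] by auto
  qed
qed

lemma alg_onD: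
  assumes "alg_on S F i n A" "j < n"
  obtains k c where "is_mpoly S k c" "c \<noteq> (\<lambda>_. 0)"
    "\<And>x. x \<in> A \<Longrightarrow> mpoly_eval k c (\<lambda>l. Dpow i l (F j) x) = 0"
  using assms unfolding alg_on_def nonzero_poly_tuple_def star_cond_def by blast

lemma alg_on_subset: "alg_on S F i n A \<Longrightarrow> B \<subseteq> A \<Longrightarrow> alg_on S F i n B"
  unfolding alg_on_def by blast

lemma alg_on_Ints_imp_UNIV: "alg_on \<int> F i n A \<Longrightarrow> alg_on UNIV F i n A"
  unfolding alg_on_def nonzero_poly_tuple_def is_mpoly_def by (elim exE conjE, intro exI conjI) auto

text \<open>Elimination concerns functions of one variable; along a line in direction
  \<open>i\<close> each iterate \<open>Dpow i l\<close> has the next one as its derivative.\<close>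

lemma alg_on_line_Ints:
  assumes F: "\<And>j. j < n \<Longrightarrow> real_analytic_on (F j) U"
    and U: "line_pt x0 i ` {a<..<b} \<subseteq> U"
    and alg: "alg_on UNIV F i n (line_pt x0 i ` {a<..<b})"
  shows "alg_on \<int> F i n (line_pt x0 i ` {a<..<b})"
proof (rule alg_onI)
  fix j assume j: "j < n"
  obtain k c where c: "is_mpoly UNIV k c" "c \<noteq> (\<lambda>_. 0)"
    "\<And>x. x \<in> line_pt x0 i ` {a<..<b} \<Longrightarrow> mpoly_eval k c (\<lambda>l. Dpow i l (F j) x) = 0"
    using alg_onD[OF alg j] by blast
  obtain e y0 where e: "ev e y0 \<noteq> 0"
    "\<And>T y t. open T \<Longrightarrow> (\<And>t l. t \<in> T \<Longrightarrow> ((\<lambda>t. y t l) has_field_derivative y t (Suc l)) (at t)) \<Longrightarrow>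
      (\<And>t. t \<in> T \<Longrightarrow> mpoly_eval k c (y t) = 0) \<Longrightarrow> t \<in> T \<Longrightarrow> ev e (y t) = 0"
    by (rule eliminate_real_coefficients[OF c(1,2)]) blast
  obtain k' c' where c': "is_mpoly \<int> k' c'" "mpoly_eval k' c' = ev e"
    using ev_eq_mpoly_eval by blast
  have "c' \<noteq> (\<lambda>_. 0)"
    using e(1) unfolding c'(2)[symmetric] by (auto simp: mpoly_eval_def)
  moreover have "ev e (\<lambda>l. Dpow i l (F j) (line_pt x0 i t)) = 0" if "t \<in> {a<..<b}" for t
  proof (rule e(2)[of "{a<..<b}" "\<lambda>t l. Dpow i l (F j) (line_pt x0 i t)"])
    show "((\<lambda>t. Dpow i l (F j) (line_pt x0 i t)) has_field_derivative
        Dpow i (Suc l) (F j) (line_pt x0 i t)) (at t)" if "t \<in> {a<..<b}" for t l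
      using U that by (intro Dpow_line_has_derivative[OF F[OF j]]) auto
    show "mpoly_eval k c (\<lambda>l. Dpow i l (F j) (line_pt x0 i t)) = 0" if "t \<in> {a<..<b}" for t
      using c(3) that by auto
  qed (use that in auto)
  ultimately show "\<exists>k c. is_mpoly \<int> k c \<and> c \<noteq> (\<lambda>_. 0) \<and>
      (\<forall>x\<in>line_pt x0 i ` {a<..<b}. mpoly_eval k c (\<lambda>l. Dpow i l (F j) x) = 0)"
    using c' by (intro exI[of _ k'] exI[of _ c']) auto
qed

lemma alg_on_connected:
  assumes F: "\<And>j. j < n \<Longrightarrow> real_analytic_on (F j) U"
    and J: "open J" "connected J" "J \<subseteq> U"
    and alg: "\<And>x. x \<in> U \<Longrightarrow> alg_on \<int> F i n {x}"
  shows "alg_on \<int> F i n J"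
proof (cases "J = {}")
  case True
  \<comment> \<open>The condition on an empty \<open>J\<close> is vacuous, but a nonzero polynomial
    must still be supplied: the constant 1.\<close>
  have "is_mpoly \<int> 0 (\<lambda>a. if a = (\<lambda>_. 0) then 1 else 0)"
    by (auto simp: is_mpoly_def)
  moreover have "(\<lambda>a. if a = (\<lambda>_. 0) then 1 else 0) \<noteq> (\<lambda>_::nat \<Rightarrow> nat. 0::real)"
    by (auto simp: fun_eq_iff)
  ultimately show ?thesis using True by (intro alg_onI) blast
next
  case False
  show ?thesis
  proof (rule alg_onI)
    fix j assume j: "j < n"
    define y where "y x = (\<lambda>l. Dpow i l (F j) x)" for x
    \<comment> \<open>The zero polynomial has to be excluded, since it vanishes on every ball.
      \<open>E\<close> is countable, whatever the arities, because \<open>iexp\<close> is.\<close>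
    define E where "E = {e. \<exists>k c. is_mpoly \<int> k c \<and> c \<noteq> (\<lambda>_. 0) \<and> mpoly_eval k c = ev e}"
    have an: "real_analytic_on (\<lambda>x. y x l) U" for l
      using real_analytic_on_Dpow[OF F[OF j]] by (simp add: y_def)
    have cont: "continuous_on J (\<lambda>x. ev e (y x))" for e
      using an J(3) real_analytic_on_imp_isCont
      by (intro continuous_on_ev continuous_at_imp_continuous_on) blast
    have "\<exists>e\<in>E. ev e (y x) = 0" if x: "x \<in> J" for x
    proof -
      have "x \<in> U" using x J(3) by blast
      obtain k c where c: "is_mpoly \<int> k c" "c \<noteq> (\<lambda>_. 0)"
        "\<And>x'. x' \<in> {x} \<Longrightarrow> mpoly_eval k c (\<lambda>l. Dpow i l (F j) x') = 0"
        using alg_onD[OF alg[OF \<open>x \<in> U\<close>] j] by blast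
      obtain e where "mpoly_eval k c = ev e"
        using intpoly_mpoly_eval[OF c(1)] unfolding intpoly_def by blast
      then have "e \<in> E" "ev e (y x) = 0"
        using c unfolding E_def y_def by auto
      then show ?thesis by blast
    qed
    then obtain e z r where e: "e \<in> E" "0 < r" "ball z r \<subseteq> J" "\<And>x. x \<in> ball z r \<Longrightarrow> ev e (y x) = 0"
      using baire_zero_ball[OF J(1) False, of E "\<lambda>e x. ev e (y x)"] cont by auto
    have "line_analytic (\<lambda>x. y x l) J" for l
      using real_analytic_on_imp_line_analytic[OF an] J(3) unfolding line_analytic_def by blast
    then have "line_analytic (\<lambda>x. ev e (y x)) J" by (rule line_analytic_ev)
    moreover have "z \<in> J" using e(2,3) by auto
    ultimately have "ev e (y x) = 0" if "x \<in> J" for x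
      using line_analytic_identity[OF J(1,2), of "\<lambda>x. ev e (y x)" z r x] e that by auto
    moreover obtain k c where "is_mpoly \<int> k c" "c \<noteq> (\<lambda>_. 0)" "mpoly_eval k c = ev e"
      using e(1) unfolding E_def by blast
    ultimately show "\<exists>k c. is_mpoly \<int> k c \<and> c \<noteq> (\<lambda>_. 0) \<and>
        (\<forall>x\<in>J. mpoly_eval k c (\<lambda>l. Dpow i l (F j) x) = 0)"
      by (intro exI[of _ k] exI[of _ c]) (simp add: y_def)
  qed
qed

lemma line_pt_self: "line_pt x0 i (x0 $ i) = x0"
  by (auto simp: line_pt_def Finite_Cartesian_Product.vec_eq_iff)

lemma open_contains_line_segment:
  assumes "open J" "x0 \<in> J"
  obtains a b where "a < x0 $ i" "x0 $ i < b" "line_pt x0 i ` {a<..<b} \<subseteq> J"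
proof -
  obtain \<epsilon> where \<epsilon>: "\<epsilon> > 0" "ball x0 \<epsilon> \<subseteq> J"
    using assms open_contains_ball by blast
  have "line_pt x0 i t \<in> ball x0 \<epsilon>" if "\<bar>t - x0 $ i\<bar> < \<epsilon>" for t
  proof -
    have "line_pt x0 i t - x0 = (t - x0 $ i) *\<^sub>R axis i 1"
      by (auto simp: line_pt_def axis_def Finite_Cartesian_Product.vec_eq_iff)
    then have "dist (line_pt x0 i t) x0 = \<bar>t - x0 $ i\<bar>"
      by (simp add: dist_norm)
    then show ?thesis using that by (simp add: dist_commute)
  qed
  then have "line_pt x0 i ` {x0 $ i - \<epsilon><..<x0 $ i + \<epsilon>} \<subseteq> J"
    using \<epsilon>(2) by (auto simp: abs_less_iff)
  then show thesis using that[of "x0 $ i - \<epsilon>" "x0 $ i + \<epsilon>"] \<epsilon>(1) by auto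
qed

theorem theorem2p1:
  fixes F :: "nat \<Rightarrow> real^'m \<Rightarrow> real" and U :: "(real^'m) set"
    and n :: nat and i :: 'm
  assumes "open U"
    and "\<forall>j<n. real_analytic_on (F j) U"
  defines "C1 S \<equiv> (\<forall>J. open J \<and> connected J \<and> J \<subseteq> U \<longrightarrow> alg_on S F i n J)"
    and "C2 S \<equiv> (\<forall>x0\<in>U. \<exists>J. open J \<and> x0 \<in> J \<and> J \<subseteq> U \<and> alg_on S F i n J)"
    and "C3 S \<equiv> (\<forall>x0\<in>U. \<exists>a b. a < x0 $ i \<and> x0 $ i < b \<and>
                   line_pt x0 i ` {a<..<b} \<subseteq> U \<and> alg_on S F i n (line_pt x0 i ` {a<..<b}))"
    and "C4 \<equiv> (\<forall>x\<in>U. alg_on \<int> F i n {x})"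
  shows "(C1 \<int> \<longleftrightarrow> C2 \<int>) \<and> (C2 \<int> \<longleftrightarrow> C3 \<int>) \<and> (C3 \<int> \<longleftrightarrow> C4)
       \<and> (C4 \<longleftrightarrow> C1 UNIV) \<and> (C1 UNIV \<longleftrightarrow> C2 UNIV) \<and> (C2 UNIV \<longleftrightarrow> C3 UNIV)"
proof -
  have 12: "C2 S" if C: "C1 S" for S
    unfolding C2_def
  proof
    fix x0 assume "x0 \<in> U"
    then obtain r where r: "r > 0" "ball x0 r \<subseteq> U" using assms(1) open_contains_ball by blast
    then have "alg_on S F i n (ball x0 r)" using C unfolding C1_def by simp
    then show "\<exists>J. open J \<and> x0 \<in> J \<and> J \<subseteq> U \<and> alg_on S F i n J"
      using r by (intro exI[of _ "ball x0 r"]) auto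
  qed
  have 23: "C3 S" if C: "C2 S" for S
    unfolding C3_def
  proof
    fix x0 assume "x0 \<in> U"
    then obtain J where J: "open J" "x0 \<in> J" "J \<subseteq> U" "alg_on S F i n J"
      using C unfolding C2_def by blast
    obtain a b where ab: "a < x0 $ i" "x0 $ i < b" "line_pt x0 i ` {a<..<b} \<subseteq> J"
      by (rule open_contains_line_segment[OF J(1,2)])
    then show "\<exists>a b. a < x0 $ i \<and> x0 $ i < b \<and> line_pt x0 i ` {a<..<b} \<subseteq> U \<and>
        alg_on S F i n (line_pt x0 i ` {a<..<b})"
      using J(3) alg_on_subset[OF J(4) ab(3)] by (intro exI[of _ a] exI[of _ b]) auto
  qed
  have 34: "C4" if C: "C3 \<int>"
    unfolding C4_def
  proof
    fix x0 assume "x0 \<in> U"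
    then obtain a b where ab: "a < x0 $ i" "x0 $ i < b" "alg_on \<int> F i n (line_pt x0 i ` {a<..<b})"
      using C unfolding C3_def by blast
    have "x0 \<in> line_pt x0 i ` {a<..<b}"
      using ab line_pt_self[of x0 i] by (intro image_eqI[of _ _ "x0 $ i"]) auto
    then show "alg_on \<int> F i n {x0}" using alg_on_subset[OF ab(3)] by simp
  qed
  have 41: "C1 \<int>" if "C4"
    unfolding C1_def
  proof (intro allI impI, elim conjE)
    fix J assume "open J" "connected J" "J \<subseteq> U"
    then show "alg_on \<int> F i n J"
      by (rule alg_on_connected[rotated]) (use that assms(2) in \<open>auto simp: C4_def\<close>)
  qed
  have ZR: "C1 UNIV" if "C1 \<int>"
    using that alg_on_Ints_imp_UNIV[of F i n] unfolding C1_def by simp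
  have RZ: "C3 \<int>" if C: "C3 UNIV"
    unfolding C3_def
  proof
    fix x0 assume "x0 \<in> U"
    then obtain a b where ab: "a < x0 $ i" "x0 $ i < b" "line_pt x0 i ` {a<..<b} \<subseteq> U"
      "alg_on UNIV F i n (line_pt x0 i ` {a<..<b})"
      using C unfolding C3_def by blast
    then show "\<exists>a b. a < x0 $ i \<and> x0 $ i < b \<and> line_pt x0 i ` {a<..<b} \<subseteq> U \<and>
        alg_on \<int> F i n (line_pt x0 i ` {a<..<b})"
      using alg_on_line_Ints[OF _ ab(3,4)] assms(2) by blast
  qed
  \<comment> \<open>The integer statements form the cycle (i), (ii), (iii), (iv), (i); the real ones
    form a detour from (i) through (i_R), (ii_R), (iii_R) back to (iii).\<close>
  show ?thesis using 12[of \<int>] 12[of UNIV] 23[of \<int>] 23[of UNIV] 34 41 ZR RZ by satx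
qed

end
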